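(* Let $\mathcal{D}$ be a reliable digraph property, let $D$ be a digraph, and let $(X,H)$ be a $\mathcal{D}$-critical cover of $D$. If $B$ is a block of the low vertex subdigraph $D[V(D,X,H,\mathcal{D})]$, then $B$ is a $\mathcal{D}$-dibrick, or a bidirected cycle of even order (that is, $B=D^\pm(C_n)$ with $n$ even), or an antidirected cycle.
   Context: All digraphs are finite, without loops and without parallel arcs (pairs of opposite arcs, called digons, are allowed). For $v\in V(D)$, $d_D(v)=(d_D^+(v),d_D^-(v))$ (out-degree, in-degree). Elements of $\mathbb{N}_0^2$ are compared coordinatewise ($(p_1,p_2)\le(q_1,q_2)$ iff $p_1\le q_1$ and $p_2\le q_2$), added coordinatewise, and multiplied by nonnegative integers coordinatewise. $\Delta(D)=(\Delta^+(D),\Delta^-(D))$ (maximum out-/in-degree; $(0,0)$ for the empty digraph). A digraph is connected if its underlying undirected graph is connected; a separating vertex of a connected digraph $D$ is a vertex $v$ such that $D-v$ has at least two components; a block of $D$ is a maximal connected subdigraph without a separating vertex. For an undirected graph $G$, $D^\pm(G)$ is the digraph obtained by replacing each edge by a digon; $K_n$, $C_n$ are the complete graph and cycle on $n$ vertices. An antidirected cycle is a digraph whose underlying graph is a cycle and in which every vertex is a source or a sink. A digraph is Eulerian if $d^+(v)=d^-(v)$ for every vertex. A digraph property is a class of digraphs closed under isomorphism; it is nontrivial if it contains a nonempty digraph but not all digraphs, hereditary if closed under induced subdigraphs, additive if closed under disjoint unions; reliable means nontrivial, hereditary and additive. For such $\mathcal{D}$, $\mathrm{CR}(\mathcal{D})$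 is the set of digraphs $D\notin\mathcal{D}$ with $D-v\in\mathcal{D}$ for all $v\in V(D)$, and $d(\mathcal{D})=(d^+(\mathcal{D}),d^-(\mathcal{D}))$ with $d^+(\mathcal{D})=\min\{\delta^+(D):D\in\mathrm{CR}(\mathcal{D})\}$, $d^-(\mathcal{D})=\min\{\delta^-(D):D\in\mathrm{CR}(\mathcal{D})\}$. A cover of a digraph $D$ is a pair $(X,H)$ where $H$ is a digraph disjoint from $D$ and $X$ assigns to each $v\in V(D)$ a set $X_v\subseteq V(H)$, such that the sets $X_v$ are pairwise disjoint with union $V(H)$, each $X_v$ is independent in $H$, and for each ordered pair $(u,v)$ of distinct vertices of $D$ the set $A_H(X_u,X_v)$ of arcs of $H$ from $X_u$ to $X_v$ is a matching (pairwise vertex-disjoint arcs) if $uv\in A(D)$ and is empty if $uv\notin A(D)$. A transversal is a set $T\subseteq V(H)$ with $|T\cap X_v|=1$ for all $v$; a partial transversal has $|T\cap X_v|\le 1$ for all $v$; $\mathrm{dom}(T:D)=\{v\in V(D):X_v\cap T\neq\varnothing\}$. A $\mathcal{D}$-transversal is a transversal $T$ with $H[T]\in\mathcal{D}$; for $v\in V(D)$ a $(\mathcal{D},v)$-transversal is a partial transversal $T$ with $\mathrm{dom}(T:D)=V(D)\setminus\{v\}$ and $H[T]\in\mathcal{D}$. $(X,H)$ is a $\mathcal{D}$-critical cover of $D$ if it has no $\mathcal{D}$-transversal but has a $(\mathcal{D},v)$-transversal for every $v\in V(D)$. $V(D,X,H,\mathcal{D})=\{v\in V(D): d_D(v)=d(\mathcal{D})\cdot|X_v|\}$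 (the low vertices), and $D[V(D,X,H,\mathcal{D})]$ is the low vertex subdigraph. A $\mathcal{D}$-dibrick is a connected digraph $B$ such that $B=D^\pm(K_n)$ with $n\ge1$, or $B=D^\pm(C_n)$ with $n\ge3$ odd, or $B\in\mathcal{D}$ with $\Delta(B)\le d(\mathcal{D})$, or $B\in\mathrm{CR}(\mathcal{D})$ is Eulerian with $d_B^+(v)=d_B^-(v)=d^+(\mathcal{D})=d^-(\mathcal{D})$ for all $v\in V(B)$. *)

theory Defs
  imports
    "HOL-Library.Infinite_Typeclass"
    "Graph_Theory.Graph_Theory"
begin

text \<open>
  Digraphs are library digraphs whose arcs are literally ordered pairs of vertices, so that they
  are determined by vertex and arc set, and a subgraph is again of this form. They may be empty.
  Undirected graphs are, as in the library, symmetric digraphs; hence the digraph obtained from an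
  undirected graph by replacing every edge by a digon is the symmetric digraph itself.
\<close>

type_synonym 'a dgraph = "('a, 'a \<times> 'a) pre_digraph"

definition simple_digraph :: "'a dgraph \<Rightarrow> bool" where
  "simple_digraph G \<longleftrightarrow> digraph G \<and> tail G = fst \<and> head G = snd"

abbreviation delete_vertex :: "'a dgraph \<Rightarrow> 'a \<Rightarrow> 'a dgraph" where
  "delete_vertex G v \<equiv> pre_digraph.del_vert G v"


subsection \<open>Degrees\<close>

definition min_out_degree :: "'a dgraph \<Rightarrow> nat" where
  "min_out_degree G = Min (out_degree G ` verts G)"

definition min_in_degree :: "'a dgraph \<Rightarrow> nat" where
  "min_in_degree G = Min (in_degree G ` verts G)"

definition max_out_degree :: "'a dgraph \<Rightarrow> nat" where
  "max_out_degree G = (if verts G = {} then 0 else Max (out_degree G ` verts G))"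

definition max_in_degree :: "'a dgraph \<Rightarrow> nat" where
  "max_in_degree G = (if verts G = {} then 0 else Max (in_degree G ` verts G))"

definition eulerian :: "'a dgraph \<Rightarrow> bool" where
  "eulerian G \<longleftrightarrow> (\<forall>v \<in> verts G. out_degree G v = in_degree G v)"


subsection \<open>Blocks\<close>

text \<open>
  The library's notion of connectedness is that of the underlying undirected graph; it excludes
  the empty digraph. The qualified name distinguishes it from topological connectedness.
\<close>

abbreviation connected_digraph :: "'a dgraph \<Rightarrow> bool" where
  "connected_digraph G \<equiv> Digraph_Component.connected G"

definition components :: "'a dgraph \<Rightarrow> 'a dgraph set" where
  "components G = {C. pre_digraph.max_subgraph G connected_digraph C}"

definition separating_vertex :: "'a dgraph \<Rightarrow> 'a \<Rightarrow> bool" where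
  "separating_vertex G v \<longleftrightarrow>
     connected_digraph G \<and> v \<in> verts G \<and> card (components (delete_vertex G v)) \<ge> 2"

definition block :: "'a dgraph \<Rightarrow> 'a dgraph \<Rightarrow> bool" where
  "block G B \<longleftrightarrow>
     pre_digraph.max_subgraph G (\<lambda>C. connected_digraph C \<and> (\<nexists>v. separating_vertex C v)) B"


subsection \<open>Cycles\<close>

definition cycle_graph :: "nat \<Rightarrow> nat pair_pre_digraph" where
  "cycle_graph n =
     \<lparr> pverts = {..<n},
       parcs = {(i, j). i < n \<and> j < n \<and> (j = (i + 1) mod n \<or> i = (j + 1) mod n)} \<rparr>"

definition bidirected_cycle :: "nat \<Rightarrow> 'a dgraph \<Rightarrow> bool" where
  "bidirected_cycle n G \<longleftrightarrow> n \<ge> 3 \<and> digraph_iso G (with_proj (cycle_graph n))"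

definition antidirected_cycle :: "'a dgraph \<Rightarrow> bool" where
  "antidirected_cycle G \<longleftrightarrow>
     (\<exists>n\<ge>3. digraph_iso (with_proj (mk_symmetric G)) (with_proj (cycle_graph n))) \<and>
     (\<forall>v \<in> verts G. in_degree G v = 0 \<or> out_degree G v = 0)"


subsection \<open>Digraph properties\<close>

text \<open>
  A class of digraphs is represented by its members with vertices in one fixed infinite type.
  Every finite digraph has an isomorphic copy there, so for isomorphism-closed classes no
  information is lost.
\<close>

definition digraph_property :: "'a::infinite dgraph set \<Rightarrow> bool" where
  "digraph_property P \<longleftrightarrow>
     (\<forall>G \<in> P. simple_digraph G) \<and>
     (\<forall>G \<in> P. \<forall>H. simple_digraph H \<and> digraph_iso G H \<longrightarrow> H \<in> P)"

definition nontrivial :: "'a::infinite dgraph set \<Rightarrow> bool" where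
  "nontrivial P \<longleftrightarrow> (\<exists>G \<in> P. verts G \<noteq> {}) \<and> (\<exists>G. simple_digraph G \<and> G \<notin> P)"

definition hereditary :: "'a::infinite dgraph set \<Rightarrow> bool" where
  "hereditary P \<longleftrightarrow> (\<forall>G \<in> P. \<forall>H. induced_subgraph H G \<longrightarrow> H \<in> P)"

definition additive :: "'a::infinite dgraph set \<Rightarrow> bool" where
  "additive P \<longleftrightarrow>
     (\<forall>G \<in> P. \<forall>H \<in> P. verts G \<inter> verts H = {} \<longrightarrow> Digraph_Component.union G H \<in> P)"

definition reliable :: "'a::infinite dgraph set \<Rightarrow> bool" where
  "reliable P \<longleftrightarrow> digraph_property P \<and> nontrivial P \<and> hereditary P \<and> additive P"

definition CR :: "'a::infinite dgraph set \<Rightarrow> 'a dgraph set" where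
  "CR P = {G. simple_digraph G \<and> G \<notin> P \<and> (\<forall>v \<in> verts G. delete_vertex G v \<in> P)}"

text \<open>
  If \<open>P\<close> is reliable then \<open>CR P\<close> is nonempty and its members are nonempty, so
  the infima over sets of naturals below are minima.
\<close>

definition d_plus :: "'a::infinite dgraph set \<Rightarrow> nat" where
  "d_plus P = (INF G \<in> CR P. min_out_degree G)"

definition d_minus :: "'a::infinite dgraph set \<Rightarrow> nat" where
  "d_minus P = (INF G \<in> CR P. min_in_degree G)"


subsection \<open>Covers\<close>

definition arcs_between :: "'a dgraph \<Rightarrow> 'a set \<Rightarrow> 'a set \<Rightarrow> ('a \<times> 'a) set" where
  "arcs_between H S T = {e \<in> arcs H. tail H e \<in> S \<and> head H e \<in> T}"

definition matching :: "('a \<times> 'a) set \<Rightarrow> bool" where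
  "matching M \<longleftrightarrow> (\<forall>e \<in> M. \<forall>f \<in> M. e \<noteq> f \<longrightarrow> {fst e, snd e} \<inter> {fst f, snd f} = {})"

definition cover :: "'a dgraph \<Rightarrow> ('a \<Rightarrow> 'a set) \<Rightarrow> 'a dgraph \<Rightarrow> bool" where
  "cover D X H \<longleftrightarrow>
     simple_digraph H \<and> verts D \<inter> verts H = {} \<and>
     (\<forall>u \<in> verts D. \<forall>v \<in> verts D. u \<noteq> v \<longrightarrow> X u \<inter> X v = {}) \<and>
     (\<Union>v \<in> verts D. X v) = verts H \<and>
     (\<forall>v \<in> verts D. arcs_between H (X v) (X v) = {}) \<and>
     (\<forall>u \<in> verts D. \<forall>v \<in> verts D. u \<noteq> v \<longrightarrow>
        (if (u, v) \<in> arcs D then matching (arcs_between H (X u) (X v))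
         else arcs_between H (X u) (X v) = {}))"

definition transversal :: "'a dgraph \<Rightarrow> ('a \<Rightarrow> 'a set) \<Rightarrow> 'a dgraph \<Rightarrow> 'a set \<Rightarrow> bool" where
  "transversal D X H T \<longleftrightarrow> T \<subseteq> verts H \<and> (\<forall>v \<in> verts D. card (T \<inter> X v) = 1)"

definition partial_transversal :: "'a dgraph \<Rightarrow> ('a \<Rightarrow> 'a set) \<Rightarrow> 'a dgraph \<Rightarrow> 'a set \<Rightarrow> bool" where
  "partial_transversal D X H T \<longleftrightarrow> T \<subseteq> verts H \<and> (\<forall>v \<in> verts D. card (T \<inter> X v) \<le> 1)"

definition transversal_dom :: "'a dgraph \<Rightarrow> ('a \<Rightarrow> 'a set) \<Rightarrow> 'a set \<Rightarrow> 'a set" where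
  "transversal_dom D X T = {v \<in> verts D. X v \<inter> T \<noteq> {}}"

definition property_transversal ::
    "'a::infinite dgraph set \<Rightarrow> 'a dgraph \<Rightarrow> ('a \<Rightarrow> 'a set) \<Rightarrow> 'a dgraph \<Rightarrow> 'a set \<Rightarrow> bool" where
  "property_transversal P D X H T \<longleftrightarrow> transversal D X H T \<and> H \<restriction> T \<in> P"

definition property_transversal_avoiding ::
    "'a::infinite dgraph set \<Rightarrow> 'a dgraph \<Rightarrow> ('a \<Rightarrow> 'a set) \<Rightarrow> 'a dgraph \<Rightarrow> 'a \<Rightarrow> 'a set \<Rightarrow> bool" where
  "property_transversal_avoiding P D X H v T \<longleftrightarrow>
     partial_transversal D X H T \<and> transversal_dom D X T = verts D - {v} \<and> H \<restriction> T \<in> P"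

definition critical_cover ::
    "'a::infinite dgraph set \<Rightarrow> 'a dgraph \<Rightarrow> ('a \<Rightarrow> 'a set) \<Rightarrow> 'a dgraph \<Rightarrow> bool" where
  "critical_cover P D X H \<longleftrightarrow>
     cover D X H \<and>
     (\<nexists>T. property_transversal P D X H T) \<and>
     (\<forall>v \<in> verts D. \<exists>T. property_transversal_avoiding P D X H v T)"

definition low_vertices ::
    "'a::infinite dgraph set \<Rightarrow> 'a dgraph \<Rightarrow> ('a \<Rightarrow> 'a set) \<Rightarrow> 'a set" where
  "low_vertices P D X =
     {v \<in> verts D. out_degree D v = d_plus P * card (X v) \<and> in_degree D v = d_minus P * card (X v)}"


subsection \<open>Dibricks\<close>

definition dibrick :: "'a::infinite dgraph set \<Rightarrow> 'a dgraph \<Rightarrow> bool" where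
  "dibrick P B \<longleftrightarrow>
     simple_digraph B \<and> connected_digraph B \<and>
     ((\<exists>n\<ge>1. complete_digraph n B) \<or>
      (\<exists>n. odd n \<and> bidirected_cycle n B) \<or>
      (B \<in> P \<and> max_out_degree B \<le> d_plus P \<and> max_in_degree B \<le> d_minus P) \<or>
      (B \<in> CR P \<and> eulerian B \<and> d_plus P = d_minus P \<and>
       (\<forall>v \<in> verts B. out_degree B v = d_plus P \<and> in_degree B v = d_minus P)))"

end

(*
  Take a transversal T of H over D - v with H[T] in P. If v is low, the critical subgraphs
  produced by adding any x in X v to T use up the degree of v exactly. Hence every x has precisely
  d(P) neighbours in T, every arc at v is covered by an arc between X v and T, and x may replace
  the token of any of its neighbours, which moves the hole from v to that neighbour. So holes slide
  along the low vertices, and freezing the tokens outside a block B gives a sliding puzzle on B.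
  Call the colours of X v that have a neighbour among the tokens on B active; their number is the
  same for all v in B.

  If it is 1, the active colours induce a copy of B in H all of whose proper induced subgraphs are
  in P, so B is in P or in CR(P). If it is at least 2, a shortest path argument gives an induced
  cycle C of B that still has two active colours when the tokens outside C are frozen. If a vertex
  of C has exactly one neighbour in an ear of C and some vertex of C has none, then the two active
  colours of the former have unequal degrees, and either one can be the larger; this contradicts
  the invariance of degrees. So C = B, or C is a triangle, and triangles with two active colours
  propagate until B is complete.
*)

theory Submission
  imports Defs
begin

text \<open>The count of active colours is constant because an active colour of v can be laid down
  on v while the hole travels to a neighbour u; the arc between them must then be covered by an
  active colour of u, and matchings make this correspondence injective both ways. Likewise every
  active colour of v meets every neighbour of v at some time, so by invariance of degrees it always
  has a contact in each direction in which v has an arc. Hence k active colours force k arcs in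
  every direction that occurs at v. At a vertex with two neighbours, two colours leave one contact
  each and the same directions towards both neighbours: a cycle is bidirected or antidirected, and a
  triangle, being odd, is bidirected.

  So a set must carry a witnessing configuration. A vertex that keeps all its neighbours keeps all
  its active colours, and the count then carries over to the whole set; this is why the
  contradiction needs a vertex of C without neighbours in the ear.\<close>

section \<open>Connected and biconnected vertex sets\<close>

text \<open>A cut condition instead of paths. The empty set counts as connected, so deleting the
  only vertex of a singleton does no harm.\<close>

definition conn :: "('v \<Rightarrow> 'v \<Rightarrow> bool) \<Rightarrow> 'v set \<Rightarrow> bool" where
  "conn E S \<longleftrightarrow> (\<forall>K. K \<subseteq> S \<longrightarrow> K \<noteq> {} \<longrightarrow> K \<noteq> S \<longrightarrow> (\<exists>a\<in>K. \<exists>b\<in>S - K. E a b))"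

text \<open>Single vertices and single edges qualify, as they do for blocks.\<close>

definition biconn :: "('v \<Rightarrow> 'v \<Rightarrow> bool) \<Rightarrow> 'v set \<Rightarrow> bool" where
  "biconn E S \<longleftrightarrow> conn E S \<and> (\<forall>v\<in>S. conn E (S - {v}))"

lemma conn_crossing:
  assumes "conn E S" "K \<subseteq> S" "K \<noteq> {}" "K \<noteq> S"
  obtains a b where "a \<in> K" "b \<in> S - K" "E a b"
proof -
  have "\<exists>a\<in>K. \<exists>b\<in>S - K. E a b" using assms unfolding conn_def by simp
  then show thesis using that by (elim bexE)
qed

text \<open>Induction along walks without walks: the vertices with \<open>Q\<close> form a nonempty
  set that no edge leaves.\<close>

lemma conn_induct:
  assumes "conn E S" "u \<in> S" "v \<in> S" "Q u"
    and step: "\<And>a b. a \<in> S \<Longrightarrow> b \<in> S \<Longrightarrow> Q a \<Longrightarrow> E a b \<Longrightarrow> Q b"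
  shows "Q v"
proof (rule ccontr)
  let ?K = "{a \<in> S. Q a}"
  assume "\<not> Q v"
  then have "?K \<subseteq> S" "?K \<noteq> {}" "?K \<noteq> S"
    using assms(2-4) by auto
  then have "\<exists>a\<in>?K. \<exists>b\<in>S - ?K. E a b"
    by (rule \<open>conn E S\<close>[unfolded conn_def, rule_format])
  then show False using step by blast
qed

lemma conn_mono:
  assumes "conn E S" "\<And>a b. a \<in> S \<Longrightarrow> b \<in> S \<Longrightarrow> E a b \<Longrightarrow> F a b"
  shows "conn F S"
  unfolding conn_def
proof (intro allI impI)
  fix K assume K: "K \<subseteq> S" "K \<noteq> {}" "K \<noteq> S"
  then obtain a b where "a \<in> K" "b \<in> S - K" "E a b" using assms(1) unfolding conn_def by blast
  then show "\<exists>a\<in>K. \<exists>b\<in>S - K. F a b" using assms(2)[of a b] K(1) by blast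
qed

lemma biconn_mono:
  assumes "biconn E S" "\<And>a b. a \<in> S \<Longrightarrow> b \<in> S \<Longrightarrow> E a b \<Longrightarrow> F a b"
  shows "biconn F S"
  unfolding biconn_def
proof (intro conjI ballI)
  show "conn F S" using assms by (auto simp: biconn_def intro: conn_mono[of E])
  show "conn F (S - {v})" if "v \<in> S" for v
    by (rule conn_mono[of E]) (use assms that in \<open>auto simp: biconn_def\<close>)
qed

lemma conn_empty [simp]: "conn E {}"
  and conn_singleton [simp]: "conn E {v}"
  by (auto simp: conn_def subset_singleton_iff)

lemma conn_Un:
  assumes sym: "symp E" and "conn E S" "conn E T" "a \<in> S" "b \<in> T" "a = b \<or> E a b"
  shows "conn E (S \<union> T)"
  unfolding conn_def
proof (intro allI impI)
  fix K assume K: "K \<subseteq> S \<union> T" "K \<noteq> {}" "K \<noteq> S \<union> T"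
  show "\<exists>a\<in>K. \<exists>b\<in>S \<union> T - K. E a b"
  proof (rule ccontr)
    assume no: "\<not> ?thesis"
    have S: "K \<inter> S = {} \<or> S \<subseteq> K" and T: "K \<inter> T = {} \<or> T \<subseteq> K"
      using assms(2,3)[unfolded conn_def, rule_format, of "K \<inter> S"]
        assms(3)[unfolded conn_def, rule_format, of "K \<inter> T"] no by blast+
    show False using S T K no assms(4,5,6) sympD[OF sym, of a b] by blast
  qed
qed

lemma conn_insert:
  assumes "symp E" "conn E S" "a \<in> S" "E a x"
  shows "conn E (insert x S)"
  using conn_Un[OF assms(1,2) conn_singleton assms(3), of x x] assms(4) by simp

lemma conn_clique:
  assumes "\<And>a b. a \<in> S \<Longrightarrow> b \<in> S \<Longrightarrow> a \<noteq> b \<Longrightarrow> E a b"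
  shows "conn E S"
  unfolding conn_def
proof (intro allI impI)
  fix K assume "K \<subseteq> S" "K \<noteq> {}" "K \<noteq> S"
  then obtain a b where "a \<in> K" "b \<in> S - K" by blast
  then show "\<exists>a\<in>K. \<exists>b\<in>S - K. E a b" using assms[of a b] \<open>K \<subseteq> S\<close> by blast
qed

lemma biconn_clique:
  assumes "\<And>a b. a \<in> S \<Longrightarrow> b \<in> S \<Longrightarrow> a \<noteq> b \<Longrightarrow> E a b"
  shows "biconn E S"
  unfolding biconn_def using assms by (auto intro!: conn_clique)

text \<open>A maximal connected proper subset containing \<open>r\<close> becomes all of
  \<open>R\<close> when a neighbour is added, so it omits exactly one vertex. Since \<open>r\<close>
  can be chosen, a second application yields a second non-cut vertex.\<close>

lemma conn_non_cut:
  assumes sym: "symp E" and "conn E R" "finite R" "r \<in> R" "R \<noteq> {r}"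
  obtains r' where "r' \<in> R" "r' \<noteq> r" "conn E (R - {r'})"
proof -
  let ?F = "{K. K \<subset> R \<and> r \<in> K \<and> conn E K}"
  have "finite ?F" using \<open>finite R\<close> by (auto intro: finite_subset[of _ "Pow R"])
  moreover have "{r} \<in> ?F" using assms by auto
  ultimately have "\<exists>K\<in>?F. {r} \<subseteq> K \<and> (\<forall>K'\<in>?F. K \<subseteq> K' \<longrightarrow> K = K')"
    by (rule finite_has_maximal2)
  then obtain K where K: "K \<in> ?F" and max: "\<forall>K'\<in>?F. K \<subseteq> K' \<longrightarrow> K = K'"
    by (elim bexE conjE)
  have KF: "K \<subset> R" "r \<in> K" "conn E K" using K by auto
  obtain a b where ab: "a \<in> K" "b \<in> R - K" "E a b"
    using conn_crossing[OF \<open>conn E R\<close>, of K] KF by blast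
  have "conn E (insert b K)" using conn_insert[OF sym KF(3) ab(1,3)] .
  then have "insert b K = R" using bspec[OF max, of "insert b K"] KF ab by blast
  then have "R - {b} = K" using ab by blast
  then show ?thesis using that[of b] KF ab by auto
qed

text \<open>Existence of a component: among the nonempty sets that no edge leaves, a minimal one is
  connected.\<close>

lemma conn_closed_minimal:
  assumes sym: "symp E" and "finite S" "S \<noteq> {}"
  obtains K where "K \<subseteq> S" "K \<noteq> {}" "conn E K" "\<And>a b. a \<in> K \<Longrightarrow> b \<in> S - K \<Longrightarrow> \<not> E a b"
proof -
  let ?F = "{K. K \<subseteq> S \<and> K \<noteq> {} \<and> (\<forall>a\<in>K. \<forall>b\<in>S - K. \<not> E a b)}"
  have "finite ?F" using \<open>finite S\<close> by (auto intro: finite_subset[of _ "Pow S"])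
  moreover have "S \<in> ?F" using assms by auto
  ultimately have "\<exists>K\<in>?F. K \<subseteq> S \<and> (\<forall>K'\<in>?F. K' \<subseteq> K \<longrightarrow> K = K')"
    by (rule finite_has_minimal2)
  then obtain K where K: "K \<in> ?F" and min: "\<forall>K'\<in>?F. K' \<subseteq> K \<longrightarrow> K = K'"
    by (elim bexE conjE)
  have "conn E K" unfolding conn_def
  proof (intro allI impI, rule ccontr)
    fix L assume L: "L \<subseteq> K" "L \<noteq> {}" "L \<noteq> K" "\<not> (\<exists>a\<in>L. \<exists>b\<in>K - L. E a b)"
    then have "L \<in> ?F" using K by auto blast
    then show False using bspec[OF min, of L] L by blast
  qed
  then show ?thesis using that K by blast
qed

text \<open>
  A minimal ear: a connected set attached to \<open>C\<close> in at least two vertices. Minimality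
  makes it either a single vertex or a path whose only attachments are one at each end.
\<close>

lemma ear:
  assumes sym: "symp E" and "finite B" "biconn E B" "C \<subset> B" "biconn E C"
    and card: "2 \<le> card C"
  obtains (vertex) w a b where "w \<in> B - C" "a \<in> C" "b \<in> C" "a \<noteq> b" "E a w" "E b w"
  | (path) R a b p q where "R \<subseteq> B - C" "R \<noteq> {}" "a \<in> C" "b \<in> C" "a \<noteq> b" "p \<in> R" "q \<in> R"
     "\<And>c r. c \<in> C \<Longrightarrow> r \<in> R \<Longrightarrow> E c r \<longleftrightarrow> (c = a \<and> r = p \<or> c = b \<and> r = q)"
     "\<And>C'. C' \<subseteq> C \<Longrightarrow> a \<in> C' \<Longrightarrow> b \<in> C' \<Longrightarrow> biconn E C' \<Longrightarrow> biconn E (C' \<union> R)"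
proof -
  have symD: "E x y \<Longrightarrow> E y x" for x y using sympD[OF sym] .
  define att where "att R = {c \<in> C. \<exists>r\<in>R. E c r}" for R
  let ?F = "{R. R \<subseteq> B - C \<and> conn E R \<and> (\<exists>a\<in>att R. \<exists>b\<in>att R. a \<noteq> b)}"
  have fin: "finite ?F" using \<open>finite B\<close> by (auto intro: finite_subset[of _ "Pow B"])
  \<comment> \<open>A component of \<open>B - C\<close>. Its leaving edges end in \<open>C\<close>;
    one ends at some \<open>a\<close>, and since \<open>B - {a}\<close> is still connected, another
    ends elsewhere.\<close>
  obtain K where K: "K \<subseteq> B - C" "K \<noteq> {}" "conn E K" "\<And>a b. a \<in> K \<Longrightarrow> b \<in> B - C - K \<Longrightarrow> \<not> E a b"
    using conn_closed_minimal[OF sym, of "B - C"] assms by auto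
  have Cne: "C \<noteq> {}" "C \<noteq> {c}" for c using card by auto
  have "\<exists>a\<in>att K. \<exists>b\<in>att K. a \<noteq> b"
  proof -
    have "K \<subseteq> B" "K \<noteq> B" using K \<open>C \<subset> B\<close> Cne(1) by auto
    then obtain x a where a: "x \<in> K" "a \<in> B - K" "E x a"
      using conn_crossing[of E B K] \<open>biconn E B\<close> K(2) unfolding biconn_def by blast
    then have aC: "a \<in> C" using K(4) by blast
    have "K \<subseteq> B - {a}" "K \<noteq> B - {a}" using K(1) aC Cne(2)[of a] \<open>C \<subset> B\<close> by auto
    then obtain y b where b: "y \<in> K" "b \<in> B - {a} - K" "E y b"
      using conn_crossing[of E "B - {a}" K] \<open>biconn E B\<close> K(2) a(2) unfolding biconn_def by blast
    then have "b \<in> C" using K(4) by blast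
    then show ?thesis using a b aC symD unfolding att_def by blast
  qed
  then have "K \<in> ?F" using K by auto
  with fin have "\<exists>R\<in>?F. R \<subseteq> K \<and> (\<forall>R'\<in>?F. R' \<subseteq> R \<longrightarrow> R = R')"
    by (rule finite_has_minimal2)
  then obtain R where R: "R \<in> ?F" and min': "\<forall>R'\<in>?F. R' \<subseteq> R \<longrightarrow> R = R'"
    by (elim bexE conjE)
  have min: "x = y" if "R' \<subset> R" "conn E R'" "x \<in> att R'" "y \<in> att R'" for R' x y
    using bspec[OF min', of R'] R that by blast
  obtain a b where ab: "a \<in> att R" "b \<in> att R" "a \<noteq> b" using R by blast
  have RB: "R \<subseteq> B - C" and connR: "conn E R" using R by auto
  then have finR: "finite R" using \<open>finite B\<close> by (blast intro: finite_subset)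
  obtain r where r: "r \<in> R" "E a r" using ab unfolding att_def by blast
  show thesis
  proof (cases "R = {r}")
    case True
    then show thesis using vertex[of r a b] ab R unfolding att_def by auto
  next
    case False
    \<comment> \<open>Removing either of two non-cut vertices leaves a smaller connected set, which
      by minimality has at most one attachment. As \<open>R\<close> has two, \<open>p\<close> alone
      sees the one and \<open>q\<close> alone the other.\<close>
    obtain p where p: "p \<in> R" "conn E (R - {p})" using conn_non_cut[OF sym connR finR r(1) False] by blast
    have "R \<noteq> {p}" using r p False by auto
    then obtain q where q: "q \<in> R" "q \<noteq> p" "conn E (R - {q})"
      using conn_non_cut[OF sym connR finR p(1)] by blast
    have attU: "att R = att {p} \<union> att (R - {p})" "att R = att {q} \<union> att (R - {q})"
      using p(1) q(1) unfolding att_def by auto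
    have sub: "att {p} \<subseteq> att (R - {q})" "att {q} \<subseteq> att (R - {p})"
      "\<And>z. z \<in> R \<Longrightarrow> z \<noteq> p \<Longrightarrow> att {z} \<subseteq> att (R - {p})" "\<And>z. z \<in> R \<Longrightarrow> z \<noteq> q \<Longrightarrow> att {z} \<subseteq> att (R - {q})"
      using p q unfolding att_def by auto
    have m1: "x = y" if "x \<in> att (R - {p})" "y \<in> att (R - {p})" for x y using min[of "R - {p}" x y] p that by blast
    have m2: "x = y" if "x \<in> att (R - {q})" "y \<in> att (R - {q})" for x y using min[of "R - {q}" x y] q that by blast
    obtain a' b' where a'b': "a' \<noteq> b'" "a' \<in> att {p}" "b' \<in> att {q}" "a' \<in> att R" "b' \<in> att R"
      "att (R - {q}) = {a'}" "att (R - {p}) = {b'}"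
    proof -
      have "\<exists>a'. a' \<in> att {p}" using ab attU(1) m1 by blast
      moreover have "\<exists>b'. b' \<in> att {q}" using ab attU(2) m2 by blast
      ultimately obtain a' b' where *: "a' \<in> att {p}" "b' \<in> att {q}" by blast
      have "att (R - {q}) = {a'}" "att (R - {p}) = {b'}" using *(1) subsetD[OF sub(1)] m2 apply blast
        using *(2) subsetD[OF sub(2)] m1 by blast
      moreover have "a' \<noteq> b'"
      proof
        assume "a' = b'"
        then have "att R \<subseteq> {a'}" using attU(1) calculation sub(1) by auto
        then show False using ab by auto
      qed
      moreover have "a' \<in> att R" "b' \<in> att R" using attU * by auto
      ultimately show ?thesis using that[of a' b'] * by metis
    qed
    have pq: "E c z \<longleftrightarrow> (c = a' \<and> z = p \<or> c = b' \<and> z = q)" if "c \<in> C" "z \<in> R" for c z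
    proof
      assume "E c z"
      then have c: "c \<in> att {z}" using that unfolding att_def by blast
      show "c = a' \<and> z = p \<or> c = b' \<and> z = q"
      proof (cases "z = p")
        case True
        then show ?thesis using c sub(1) a'b'(6) by auto
      next
        case zp: False
        then have "c = b'" using c sub(3)[OF that(2)] a'b'(7) by auto
        moreover have "z = q"
        proof (rule ccontr)
          assume "z \<noteq> q"
          then have "c = a'" using c sub(4)[OF that(2)] a'b'(6) by auto
          then show False using \<open>c = b'\<close> a'b'(1) by simp
        qed
        ultimately show ?thesis by simp
      qed
    next
      assume "c = a' \<and> z = p \<or> c = b' \<and> z = q"
      then show "E c z" using a'b'(2,3) unfolding att_def by auto
    qed
    have EaP: "E a' p" and EbQ: "E b' q" using a'b'(2,3) unfolding att_def by auto
    have "biconn E (C' \<union> R)" if C': "C' \<subseteq> C" "a' \<in> C'" "b' \<in> C'" "biconn E C'" for C'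
    proof -
      have disj: "C' \<inter> R = {}" using C'(1) RB by blast
      have "conn E (C' \<union> R - {v})" if v: "v \<in> C' \<union> R" for v
      proof (cases "v \<in> C'")
        case True
        then have eq: "C' \<union> R - {v} = (C' - {v}) \<union> R" using disj by blast
        have cc: "conn E (C' - {v})" using C' True unfolding biconn_def by blast
        show ?thesis
        proof (cases "v = a'")
          case False
          show ?thesis unfolding eq
            by (rule conn_Un[OF sym cc connR, of a' p]) (use C' False p EaP in auto)
        next
          case True
          show ?thesis unfolding eq
            by (rule conn_Un[OF sym cc connR, of b' q]) (use C' True q EbQ a'b' in auto)
        qed
      next
        case False
        then have vR: "v \<in> R" and eq: "C' \<union> R - {v} = C' \<union> (R - {v})" using v by auto
        show ?thesis unfolding eq conn_def
        proof (intro allI impI, rule ccontr)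
          fix L assume L: "L \<subseteq> C' \<union> (R - {v})" "L \<noteq> {}" "L \<noteq> C' \<union> (R - {v})"
            and noL: "\<not> (\<exists>x\<in>L. \<exists>y\<in>C' \<union> (R - {v}) - L. E x y)"
          \<comment> \<open>Whichever of \<open>L\<close> and its complement avoids
            \<open>C'\<close>: a part of \<open>R - {v}\<close> that is cut off from everything
            else.\<close>
          define M where "M = (if C' \<subseteq> L then C' \<union> (R - {v}) - L else L)"
          have dich: "C' \<subseteq> L \<or> C' \<inter> L = {}"
          proof (rule ccontr)
            assume "\<not> ?thesis"
            then obtain x y where "x \<in> L \<inter> C'" "y \<in> C' - (L \<inter> C')" "E x y"
              using conn_crossing[of E C' "L \<inter> C'"] C'(4) unfolding biconn_def by blast
            then show False using noL by blast
          qed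
          have M: "M \<subseteq> R - {v}" "M \<noteq> {}" using L dich unfolding M_def by (auto split: if_splits)
          have noM: "\<not> E x y" if "x \<in> M" "y \<in> C' \<union> (R - {v}) - M" for x y
            using noL that dich symD[of x y] unfolding M_def by (auto split: if_splits)
          \<comment> \<open>Edges leave \<open>M\<close> only towards \<open>v\<close>, so dropping
            \<open>M\<close> keeps \<open>R\<close> connected. As \<open>p\<close> and
            \<open>q\<close> survive, both attachments do, against minimality.\<close>
          have "conn E (R - M)" unfolding conn_def
          proof (intro allI impI)
            fix N assume N: "N \<subseteq> R - M" "N \<noteq> {}" "N \<noteq> R - M"
            show "\<exists>a\<in>N. \<exists>b\<in>R - M - N. E a b"
            proof (cases "v \<in> N")
              case True
              have "N \<union> M \<subseteq> R" "N \<union> M \<noteq> {}" "N \<union> M \<noteq> R" using N M by auto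
              then obtain x y where xy: "x \<in> N \<union> M" "y \<in> R - (N \<union> M)" "E x y"
                using conn_crossing[OF connR] by metis
              then have "x \<notin> M" using noM[of x y] True by auto
              then show ?thesis using xy by blast
            next
              case False
              have "N \<subseteq> R" "N \<noteq> R" using N M by auto
              then obtain x y where xy: "x \<in> N" "y \<in> R - N" "E x y"
                using conn_crossing[OF connR _ N(2)] by metis
              then have "y \<notin> M" using noM[of y x] symD[of x y] False N(1) by auto
              then show ?thesis using xy by blast
            qed
          qed
          moreover have "R - M \<subset> R" using M by blast
          moreover have "p \<notin> M" "q \<notin> M"
            using noM[of p a'] noM[of q b'] symD[OF EaP] symD[OF EbQ] C' M disj by auto
          then have "a' \<in> att (R - M)" "b' \<in> att (R - M)" using p(1) q(1) EaP EbQ C' unfolding att_def by auto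
          ultimately show False using min a'b'(1) by blast
        qed
      qed
      moreover have "conn E (C' \<union> R)"
        by (rule conn_Un[OF sym _ connR, of _ a' p]) (use C' p EaP in \<open>auto simp: biconn_def\<close>)
      ultimately show ?thesis unfolding biconn_def by blast
    qed
    moreover have "a' \<in> C" "b' \<in> C" using a'b' unfolding att_def by auto
    moreover have "R \<noteq> {}" using p by auto
    ultimately show thesis using path[of R a' b' p q] RB pq a'b'(1) p(1) q(1) by blast
  qed
qed

section \<open>Sliding puzzles\<close>

text \<open>
  The boolean selects a direction: \<open>R True u v\<close> stands for an arc from \<open>u\<close> to \<open>v\<close> and
  \<open>R False u v\<close> for one from \<open>v\<close> to \<open>u\<close>. This treats out- and in-degrees uniformly.
\<close>

locale token_system =
  fixes R :: "bool \<Rightarrow> 'v \<Rightarrow> 'v \<Rightarrow> bool"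
    and A :: "bool \<Rightarrow> 'c \<Rightarrow> 'c \<Rightarrow> bool"
    and X :: "'v \<Rightarrow> 'c set"
  assumes R_not: "R (\<not> b) u v \<longleftrightarrow> R b v u"
    and A_not: "A (\<not> b) x y \<longleftrightarrow> A b y x"
    and R_irrefl: "\<not> R b v v"
    and A_imp_R: "x \<in> X u \<Longrightarrow> y \<in> X v \<Longrightarrow> A b x y \<Longrightarrow> R b u v"
    and A_right_unique: "x \<in> X u \<Longrightarrow> y \<in> X v \<Longrightarrow> y' \<in> X v \<Longrightarrow> A b x y \<Longrightarrow> A b x y' \<Longrightarrow> y = y'"
    and finite_X: "finite (X v)"
begin

lemma A_left_unique:
  "x \<in> X u \<Longrightarrow> x' \<in> X u \<Longrightarrow> y \<in> X v \<Longrightarrow> A b x y \<Longrightarrow> A b x' y \<Longrightarrow> x = x'"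
  using A_right_unique[of y v x u x' "\<not> b"] A_not[of b] by blast

definition E :: "'v \<Rightarrow> 'v \<Rightarrow> bool" where
  "E u v \<longleftrightarrow> (\<exists>b. R b u v)"

lemma symp_E: "symp E"
  unfolding E_def symp_def using R_not by metis

lemma E_sym: "E u v \<Longrightarrow> E v u"
  using symp_E by (rule sympD)

lemma E_irrefl [simp]: "\<not> E v v"
  unfolding E_def using R_irrefl by blast

lemma R_imp_E: "R b u v \<Longrightarrow> E u v"
  unfolding E_def by blast

lemma A_imp_E: "x \<in> X u \<Longrightarrow> y \<in> X v \<Longrightarrow> A b x y \<Longrightarrow> E u v"
  using A_imp_R R_imp_E by blast

text \<open>
  A pair \<open>(v, t)\<close> is a configuration with hole \<open>v\<close> in which every other
  vertex \<open>u\<close> of \<open>S\<close> carries the token \<open>t u\<close>. The fourth condition says that the hole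
  may move along an arc while the token on its other end is dropped.
\<close>

definition sliding :: "'v set \<Rightarrow> ('v \<times> ('v \<Rightarrow> 'c)) set \<Rightarrow> bool" where
  "sliding S T \<longleftrightarrow> finite S \<and>
     (\<forall>v t. (v, t) \<in> T \<longrightarrow> v \<in> S \<and> (\<forall>u\<in>S - {v}. t u \<in> X u)) \<and>
     (\<forall>v t t' x b. (v, t) \<in> T \<longrightarrow> (v, t') \<in> T \<longrightarrow> x \<in> X v \<longrightarrow>
        card {u \<in> S - {v}. A b x (t u)} = card {u \<in> S - {v}. A b x (t' u)}) \<and>
     (\<forall>v t x u b. (v, t) \<in> T \<longrightarrow> x \<in> X v \<longrightarrow> u \<in> S - {v} \<longrightarrow> A b x (t u) \<longrightarrow> (u, t(v := x)) \<in> T) \<and>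
     (\<forall>v t u b. (v, t) \<in> T \<longrightarrow> u \<in> S - {v} \<longrightarrow> R b v u \<longrightarrow> (\<exists>x\<in>X v. A b x (t u)))"

definition deg :: "'v set \<Rightarrow> bool \<Rightarrow> 'v \<Rightarrow> ('v \<Rightarrow> 'c) \<Rightarrow> 'c \<Rightarrow> nat" where
  "deg S b v t x = card {u \<in> S - {v}. A b x (t u)}"

text \<open>The active colours. Activity is required in one configuration only; invariance of
  degrees extends it to all configurations with the same hole, see
  \<open>col_adjacent\<close>.\<close>

definition col :: "'v set \<Rightarrow> ('v \<times> ('v \<Rightarrow> 'c)) set \<Rightarrow> 'v \<Rightarrow> 'c set" where
  "col S T v = {x \<in> X v. \<exists>t b u. (v, t) \<in> T \<and> u \<in> S - {v} \<and> A b x (t u)}"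

lemma finite_col: "finite (col S T v)"
  unfolding col_def using finite_X by simp

lemma colI: "(v, t) \<in> T \<Longrightarrow> x \<in> X v \<Longrightarrow> u \<in> S - {v} \<Longrightarrow> A b x (t u) \<Longrightarrow> x \<in> col S T v"
  unfolding col_def by blast

definition restr :: "'v set \<Rightarrow> 'v set \<Rightarrow> ('v \<times> ('v \<Rightarrow> 'c)) set \<Rightarrow> ('v \<Rightarrow> 'c) \<Rightarrow> ('v \<times> ('v \<Rightarrow> 'c)) set" where
  "restr S C T t = {(v, t') \<in> T. v \<in> C \<and> (\<forall>u\<in>S - C. t' u = t u)}"

lemma restr_self: "(v, t) \<in> T \<Longrightarrow> v \<in> C \<Longrightarrow> (v, t) \<in> restr S C T t"
  unfolding restr_def by auto

context
  fixes S T assumes sliding: "sliding S T"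
begin

lemma finite_S: "finite S"
  using sliding unfolding sliding_def by (elim conjE)

lemma hole_in: "(v, t) \<in> T \<Longrightarrow> v \<in> S"
  and token_in: "(v, t) \<in> T \<Longrightarrow> u \<in> S \<Longrightarrow> u \<noteq> v \<Longrightarrow> t u \<in> X u"
  using sliding[unfolded sliding_def, THEN conjunct2, THEN conjunct1, rule_format, of v t] by auto

lemma deg_invariant:
  "(v, t) \<in> T \<Longrightarrow> (v, t') \<in> T \<Longrightarrow> x \<in> X v \<Longrightarrow> deg S b v t x = deg S b v t' x"
  unfolding deg_def
  by (rule sliding[unfolded sliding_def, THEN conjunct2, THEN conjunct2, THEN conjunct1, rule_format])

lemma move:
  "(v, t) \<in> T \<Longrightarrow> x \<in> X v \<Longrightarrow> u \<in> S \<Longrightarrow> u \<noteq> v \<Longrightarrow> A b x (t u) \<Longrightarrow> (u, t(v := x)) \<in> T"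
  by (rule sliding[unfolded sliding_def, THEN conjunct2, THEN conjunct2, THEN conjunct2,
        THEN conjunct1, rule_format, of v t x u b]) auto

lemma covered:
  assumes "(v, t) \<in> T" "u \<in> S" "R b v u"
  shows "\<exists>x\<in>X v. A b x (t u)"
proof -
  have "u \<in> S - {v}" using assms R_irrefl by auto
  then show ?thesis
    using sliding[unfolded sliding_def, THEN conjunct2, THEN conjunct2, THEN conjunct2,
        THEN conjunct2, rule_format, of v t u b] assms(1,3) by blast
qed

lemma deg_pos: "u \<in> S \<Longrightarrow> u \<noteq> v \<Longrightarrow> A b x (t u) \<Longrightarrow> 0 < deg S b v t x"
  unfolding deg_def using finite_S by (auto simp: card_gt_0_iff)

lemma deg_posD: "0 < deg S b v t x \<Longrightarrow> \<exists>u\<in>S - {v}. A b x (t u)"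
  unfolding deg_def by (metis (mono_tags, lifting) card.empty empty_Collect_eq not_less_zero)

text \<open>Every arc at the hole is covered, so the hole can cross it, and only tokens on its way
  change.\<close>

lemma hole_moves:
  assumes "conn E U" "U \<subseteq> S" "v \<in> U" "w \<in> U" "(v, t) \<in> T"
  shows "\<exists>t'. (w, t') \<in> T \<and> (\<forall>u. u \<notin> U \<longrightarrow> t' u = t u)"
proof (rule conn_induct[OF assms(1,3,4)])
  show "\<exists>t'. (v, t') \<in> T \<and> (\<forall>u. u \<notin> U \<longrightarrow> t' u = t u)" using assms by blast
next
  fix a b assume ab: "a \<in> U" "b \<in> U" "\<exists>t'. (a, t') \<in> T \<and> (\<forall>u. u \<notin> U \<longrightarrow> t' u = t u)" "E a b"
  then obtain t' c where t': "(a, t') \<in> T" "\<forall>u. u \<notin> U \<longrightarrow> t' u = t u" "R c a b"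
    unfolding E_def by blast
  then obtain x where x: "x \<in> X a" "A c x (t' b)" using covered ab assms by blast
  have "a \<noteq> b" using ab by auto
  then have "(b, t'(a := x)) \<in> T" using move[OF t'(1) x(1) _ _ x(2)] ab assms(2) by blast
  then show "\<exists>t'. (b, t') \<in> T \<and> (\<forall>u. u \<notin> U \<longrightarrow> t' u = t u)"
    using t' ab by (intro exI[of _ "t'(a := x)"]) auto
qed

lemma exists_hole:
  assumes "conn E S" "T \<noteq> {}" "w \<in> S"
  shows "\<exists>t. (w, t) \<in> T"
proof -
  obtain v t where "(v, t) \<in> T" using assms by auto
  then show ?thesis using hole_moves[OF assms(1) subset_refl _ assms(3)] hole_in by blast
qed

text \<open>A degree that is positive in one configuration is positive in all with the same hole;
  the touched vertex may differ.\<close>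

lemma col_adjacent:
  assumes "x \<in> col S T v" "(v, t) \<in> T"
  shows "\<exists>b. \<exists>u\<in>S - {v}. A b x (t u)"
proof -
  obtain t' b u where t': "(v, t') \<in> T" "u \<in> S - {v}" "A b x (t' u)" "x \<in> X v"
    using assms unfolding col_def by blast
  then have "0 < deg S b v t' x" using deg_pos[of u v b x t'] by simp
  then have "0 < deg S b v t x" using deg_invariant[of v t' t x b] t' assms by simp
  then show ?thesis using deg_posD by blast
qed

lemma restr_sliding:
  assumes "C \<subseteq> S"
  shows "sliding C (restr S C T t0)"
proof -
  have split: "card {u \<in> S - {v}. A b x (t u)} = card {u \<in> C - {v}. A b x (t u)} + card {u \<in> S - C. A b x (t0 u)}"
    if "(v, t) \<in> restr S C T t0" for v t x b
  proof -
    have "{u \<in> S - {v}. A b x (t u)} = {u \<in> C - {v}. A b x (t u)} \<union> {u \<in> S - C. A b x (t0 u)}"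
      using that assms unfolding restr_def by auto
    then show ?thesis using finite_S assms by (auto intro!: card_Un_disjoint intro: finite_subset)
  qed
  show ?thesis
    unfolding sliding_def
  proof (intro conjI allI impI)
    show "finite C" using finite_S assms finite_subset by blast
  next
    fix v t assume vt: "(v, t) \<in> restr S C T t0"
    then show "v \<in> C" "\<forall>u\<in>C - {v}. t u \<in> X u"
      using token_in[of v t] assms unfolding restr_def by auto
    fix u b x assume u: "u \<in> C - {v}"
    { assume "R b v u" then show "\<exists>x\<in>X v. A b x (t u)" using covered[of v t u b] vt u assms unfolding restr_def by auto }
    { assume "x \<in> X v" "A b x (t u)"
      then show "(u, t(v := x)) \<in> restr S C T t0" using move[of v t x u b] vt u assms unfolding restr_def by auto }
  next
    fix v t t' x b
    assume *: "(v, t) \<in> restr S C T t0" "(v, t') \<in> restr S C T t0" "x \<in> X v"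
    then have "deg S b v t x = deg S b v t' x" using deg_invariant unfolding restr_def by blast
    then show "card {u \<in> C - {v}. A b x (t u)} = card {u \<in> C - {v}. A b x (t' u)}"
      using split[OF *(1)] split[OF *(2)] unfolding deg_def by simp
  qed
qed

text \<open>Covering gives each arc at the hole a colour and uniqueness of partners gives it only
  one, so the active colours partition the neighbourhood.\<close>

lemma sum_deg:
  assumes "(v, t) \<in> T"
  shows "(\<Sum>x\<in>col S T v. deg S b v t x) = card {u \<in> S. R b v u}"
proof -
  have "(\<Sum>x\<in>col S T v. deg S b v t x) = card (\<Union>x\<in>col S T v. {u \<in> S - {v}. A b x (t u)})"
    unfolding deg_def
  proof (rule card_UN_disjoint[symmetric])
    show "\<forall>x\<in>col S T v. \<forall>y\<in>col S T v. x \<noteq> y \<longrightarrow>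
        {u \<in> S - {v}. A b x (t u)} \<inter> {u \<in> S - {v}. A b y (t u)} = {}"
      using A_left_unique token_in[OF assms] unfolding col_def by blast
  qed (use finite_col finite_S in auto)
  also have "(\<Union>x\<in>col S T v. {u \<in> S - {v}. A b x (t u)}) = {u \<in> S. R b v u}"
  proof (intro set_eqI iffI)
    fix u assume "u \<in> (\<Union>x\<in>col S T v. {u \<in> S - {v}. A b x (t u)})"
    then show "u \<in> {u \<in> S. R b v u}"
      using A_imp_R token_in[OF assms, of u] unfolding col_def by auto
  next
    fix u assume u: "u \<in> {u \<in> S. R b v u}"
    then obtain x where "x \<in> X v" "A b x (t u)" using covered[OF assms] by blast
    moreover have "u \<noteq> v" using u R_irrefl by auto
    ultimately show "u \<in> (\<Union>x\<in>col S T v. {u \<in> S - {v}. A b x (t u)})"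
      using colI[OF assms, of x u S b] u by auto
  qed
  finally show ?thesis .
qed

context
  assumes bic: "biconn E S" and nonempty: "T \<noteq> {}"
begin

lemma connS: "conn E S" using bic unfolding biconn_def by simp

text \<open>Let the hole leave \<open>v\<close> by laying down \<open>x\<close>, then lead it to
  \<open>u\<close> inside \<open>S - {v}\<close>. That this set is connected is the main use of
  biconnectedness.\<close>

lemma col_reached:
  assumes "x \<in> col S T v" "u \<in> S" "u \<noteq> v"
  shows "\<exists>t. (u, t) \<in> T \<and> t v = x"
proof -
  obtain t b w where t: "(v, t) \<in> T" "w \<in> S - {v}" "A b x (t w)" "x \<in> X v"
    using assms(1) unfolding col_def by blast
  have 1: "(w, t(v := x)) \<in> T" using move[of v t x w b] t by simp
  have "conn E (S - {v})" using bic hole_in[OF t(1)] unfolding biconn_def by simp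
  then obtain t' where "(u, t') \<in> T" "\<forall>z. z \<notin> S - {v} \<longrightarrow> t' z = (t(v := x)) z"
    using hole_moves[of "S - {v}" w u "t(v := x)"] 1 t(2) assms(2,3) by auto
  then show ?thesis by auto
qed

text \<open>With the hole at \<open>u\<close> and token \<open>x\<close> on \<open>v\<close>, the
  arc between them is covered; the covering colour is the partner of \<open>x\<close>.\<close>

lemma col_matched:
  assumes "R b v u" "v \<in> S" "u \<in> S" "x \<in> col S T v"
  shows "\<exists>y\<in>col S T u. A b x y"
proof -
  have ne: "u \<noteq> v" using assms R_irrefl by auto
  obtain t where t: "(u, t) \<in> T" "t v = x" using col_reached[OF assms(4,3) ne] by blast
  have "R (\<not> b) u v" using assms R_not by blast
  then obtain y where y: "y \<in> X u" "A (\<not> b) y (t v)" using covered[of u t v "\<not> b"] t(1) assms(2) by blast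
  then have "y \<in> col S T u" using colI[of u t T y v S "\<not> b"] t(1) assms(2) ne by simp
  moreover have "A b x y" using y t A_not by blast
  ultimately show ?thesis by blast
qed

lemma card_col_le:
  assumes "R b v u" "v \<in> S" "u \<in> S"
  shows "card (col S T v) \<le> card (col S T u)"
proof -
  obtain f where f: "\<And>x. x \<in> col S T v \<Longrightarrow> f x \<in> col S T u \<and> A b x (f x)"
    using col_matched[OF assms] by metis
  have "inj_on f (col S T v)"
  proof (rule inj_onI)
    fix x y assume "x \<in> col S T v" "y \<in> col S T v" "f x = f y"
    then show "x = y" using A_left_unique[of x v y "f x" u b] f[of x] f[of y] unfolding col_def by simp
  qed
  moreover have "f ` col S T v \<subseteq> col S T u" using f by blast
  ultimately show ?thesis by (rule card_inj_on_le[OF _ _ finite_col])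
qed

text \<open>Distinct colours have distinct partners, in both directions along an edge, so the count
  is carried along every edge.\<close>

lemma card_col:
  assumes "v \<in> S" "u \<in> S"
  shows "card (col S T v) = card (col S T u)"
proof (rule conn_induct[OF connS assms])
  fix a b assume ab: "a \<in> S" "b \<in> S" "card (col S T v) = card (col S T a)" "E a b"
  then obtain c where c: "R c a b" unfolding E_def by blast
  then have "R (\<not> c) b a" using R_not by blast
  then show "card (col S T v) = card (col S T b)"
    using card_col_le[OF c] card_col_le[of "\<not> c" b a] ab by force
qed simp

text \<open>The partner of \<open>x\<close> at \<open>u\<close> is active itself, so it can lie on
  \<open>u\<close> while the hole is at \<open>v\<close>.\<close>

lemma col_attained:
  assumes "R b v u" "v \<in> S" "u \<in> S" "x \<in> col S T v"
  shows "\<exists>t. (v, t) \<in> T \<and> A b x (t u)"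
proof -
  obtain y where y: "y \<in> col S T u" "A b x y" using col_matched[OF assms] by blast
  have "u \<noteq> v" using assms R_irrefl by auto
  then obtain t where "(v, t) \<in> T" "t u = y" using col_reached[OF y(1) assms(2)] by blast
  then show ?thesis using y by blast
qed

text \<open>The contact attained in one configuration counts in all of them, by invariance.\<close>

lemma deg_ge_1:
  assumes "R b v u" "v \<in> S" "u \<in> S" "x \<in> col S T v" "(v, t) \<in> T"
  shows "1 \<le> deg S b v t x"
proof -
  obtain t' where t': "(v, t') \<in> T" "A b x (t' u)" using col_attained[OF assms(1-4)] by blast
  have "u \<noteq> v" using assms R_irrefl by auto
  then have "1 \<le> deg S b v t' x" using deg_pos[of u v b x t'] assms(3) t'(2) by simp
  moreover have "x \<in> X v" using assms unfolding col_def by blast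
  ultimately show ?thesis using deg_invariant[of v t' t x b] t'(1) assms(5) by simp
qed

text \<open>A single arc in direction \<open>b\<close> already forces one for every active colour,
  and no arc serves two colours.\<close>

lemma card_col_le_degree:
  assumes "R b v u" "v \<in> S" "u \<in> S"
  shows "card (col S T v) \<le> card {u \<in> S. R b v u}"
proof -
  obtain t where t: "(v, t) \<in> T" using exists_hole[OF connS nonempty assms(2)] by blast
  have "card (col S T v) = (\<Sum>x\<in>col S T v. 1)" by simp
  also have "\<dots> \<le> (\<Sum>x\<in>col S T v. deg S b v t x)"
    using deg_ge_1[OF assms _ t] by (intro sum_mono) auto
  finally show ?thesis using sum_deg[OF t] by simp
qed

text \<open>Every direction that occurs at \<open>v\<close> has at least two arcs, hence one to each
  neighbour. So there is room for exactly two colours, with one arc each; in a direction that does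
  not occur both degrees are 0.\<close>

lemma two_neighbours:
  assumes "v \<in> S" "p \<in> S" "q \<in> S" "p \<noteq> q" "\<And>u. u \<in> S \<Longrightarrow> E v u \<longleftrightarrow> u = p \<or> u = q"
    and "2 \<le> card (col S T v)"
  shows "R b v p \<longleftrightarrow> R b v q"
    and "card (col S T v) = 2"
    and "(v, t) \<in> T \<Longrightarrow> x \<in> col S T v \<Longrightarrow> y \<in> col S T v \<Longrightarrow> deg S b v t x = deg S b v t y"
proof -
  have nb: "{u \<in> S. R b v u} \<subseteq> {p, q}" for b using assms(5) R_imp_E by blast
  have iff: "R b v p \<longleftrightarrow> R b v q" for b
  proof (rule ccontr)
    assume "\<not> ?thesis"
    then obtain u where u: "R b v u" "u \<in> S" "{u \<in> S. R b v u} \<subseteq> {u}" using nb[of b] assms(2,3) by blast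
    then have "card (col S T v) \<le> card {u}" using card_col_le_degree[OF u(1) assms(1) u(2)]
        card_mono[OF _ u(3)] by simp
    then show False using assms(6) by simp
  qed
  show "R b v p \<longleftrightarrow> R b v q" by (rule iff)
  have both: "{u \<in> S. R b v u} = {p, q}" if "R b v p" for b using nb[of b] that iff assms(2,3) by blast
  obtain b0 where b0: "R b0 v p" using assms(5)[OF assms(2)] unfolding E_def by blast
  have two: "card {p, q} = 2" using assms(4) by simp
  show c2: "card (col S T v) = 2"
    using card_col_le_degree[OF b0 assms(1,2)] both[OF b0] two assms(6) by simp
  show "deg S b v t x = deg S b v t y" if t: "(v, t) \<in> T" and xy: "x \<in> col S T v" "y \<in> col S T v"
  proof (cases "R b v p")
    case True
    have "x = y \<or> col S T v = {x, y}"
    proof -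
      obtain z z' where "col S T v = {z, z'}" using c2 unfolding card_2_iff by blast
      then show ?thesis using xy by auto
    qed
    then show ?thesis
    proof
      assume *: "col S T v = {x, y}"
      then have "x \<noteq> y" using c2 by auto
      then have "deg S b v t x + deg S b v t y = 2" using sum_deg[OF t, of b] both[OF True] two * by simp
      then show ?thesis using deg_ge_1[OF True assms(1,2) _ t, of x] deg_ge_1[OF True assms(1,2) _ t, of y] xy by simp
    qed simp
  next
    case False
    then have "{u \<in> S. R b v u} = {}" using nb[of b] iff by blast
    then have "(\<Sum>x\<in>col S T v. deg S b v t x) = 0" by (simp only: sum_deg[OF t] card.empty)
    then show ?thesis using xy finite_col by simp
  qed
qed

end
end

text \<open>Freezing \<open>S - C\<close> silences no colour of \<open>c\<close>, hence by constancy
  of the count none of \<open>s\<close>. On \<open>C\<close> the two colours of \<open>s\<close>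
  have equal degree, and the token on \<open>w\<close> adds one to whichever it touches. Either of
  them can be the one touched, so their degrees in \<open>S\<close> are not invariant.\<close>

lemma unbalanced_split_False:
  assumes sl: "sliding S T" "T \<noteq> {}" "biconn E S" and C: "C \<subseteq> S" "biconn E C"
    and c: "c \<in> C" "\<And>u. u \<in> S - C \<Longrightarrow> \<not> E c u" and two: "2 \<le> card (col S T c)"
    and s: "s \<in> C" "p \<in> C" "q \<in> C" "p \<noteq> q" "\<And>u. u \<in> C \<Longrightarrow> E s u \<longleftrightarrow> u = p \<or> u = q"
    and w: "w \<in> S - C" "\<And>u. u \<in> S - C \<Longrightarrow> E s u \<longleftrightarrow> u = w"
  shows False
proof -
  obtain b where b: "R b s w" using w(2)[OF w(1)] unfolding E_def by blast
  have sS: "s \<in> S" and cS: "c \<in> S" using s c C by auto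
  have wne: "w \<noteq> s" "w \<in> S" using w s by auto
  \<comment> \<open>Outside \<open>C\<close>, a colour of \<open>s\<close> can touch only the token
    on \<open>w\<close>.\<close>
  have split: "deg S b s t x = deg C b s t x + (if A b x (t w) then 1 else 0)"
    if "(s, t) \<in> T" "x \<in> X s" for t x
  proof -
    have "{u \<in> S - {s}. A b x (t u)} = {u \<in> C - {s}. A b x (t u)} \<union> {u \<in> {w}. A b x (t u)}"
      
    proof -
      have "u = w" if "u \<in> S - C" "A b x (t u)" for u
        using that A_imp_E[of x s "t u" u b] \<open>x \<in> X s\<close> token_in[OF sl(1), of s t u] \<open>(s, t) \<in> T\<close> w(2)[of u] s(1) by auto
      then show ?thesis using w(1) s(1) C(1) by auto
    qed
    then have "deg S b s t x = deg C b s t x + card {u \<in> {w}. A b x (t u)}"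
      unfolding deg_def using w finite_subset[OF C(1) finite_S[OF sl(1)]] by (auto intro!: card_Un_disjoint)
    moreover have "{u \<in> {w}. A b x (t u)} = (if A b x (t w) then {w} else {})" by auto
    ultimately show ?thesis by simp
  qed
  have key: "card (col S T s) = 2 \<and> (\<forall>x\<in>col S T s. \<forall>y\<in>col S T s. deg C b s t x = deg C b s t y)"
    if t: "(s, t) \<in> T" for t
  proof -
    let ?T = "restr S C T t"
    have slC: "sliding C ?T" using restr_sliding[OF sl(1) C(1)] .
    have tT: "(s, t) \<in> ?T" using restr_self[OF t s(1)] .
    then have ne: "?T \<noteq> {}" by auto
    have sub: "col C ?T v \<subseteq> col S T v" if "v \<in> C" for v unfolding col_def restr_def using C(1) by auto
    obtain t1 where t1: "(c, t1) \<in> ?T"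
      using exists_hole[OF slC _ ne c(1)] C(2) unfolding biconn_def by blast
    have t1T: "(c, t1) \<in> T" using t1 unfolding restr_def by auto
    \<comment> \<open>Whatever a colour of \<open>c\<close> touches lies in \<open>C\<close>, so it
      stays in play.\<close>
    have "col S T c \<subseteq> col C ?T c"
    proof
      fix x assume x: "x \<in> col S T c"
      then have xX: "x \<in> X c" unfolding col_def by auto
      obtain b u where u: "u \<in> S - {c}" "A b x (t1 u)" using col_adjacent[OF sl(1) x t1T] by blast
      then have "E c u" using A_imp_E[of x c "t1 u" u b] xX token_in[OF sl(1), of c t1 u] t1T by simp
      then have "u \<in> C" using c(2) u(1) by blast
      then show "x \<in> col C ?T c" using colI[of c t1 ?T x u C b] t1 xX u by blast
    qed
    then have "col C ?T c = col S T c" using sub c(1) by blast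
    then have cards: "card (col C ?T s) = card (col S T s)" "2 \<le> card (col C ?T s)"
      using card_col[OF slC C(2) ne s(1) c(1)] card_col[OF sl(1,3,2) sS cS] two by auto
    then have eq: "col C ?T s = col S T s" using card_subset_eq[OF finite_col sub[OF s(1)]] by blast
    show ?thesis
      using two_neighbours(2,3)[OF slC C(2) ne s(1-4) s(5) cards(2)] tT unfolding eq by blast
  qed
  obtain t where t: "(s, t) \<in> T" using exists_hole[OF sl(1) _ sl(2) sS] sl(3) unfolding biconn_def by blast
  obtain x where x: "x \<in> X s" "A b x (t w)" using covered[OF sl(1), of s t w b] t b w by blast
  have xc: "x \<in> col S T s" using colI[of s t T x w S b] t x w s by auto
  obtain z z' where "col S T s = {z, z'}" "z \<noteq> z'" using key[OF t] unfolding card_2_iff by blast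
  then obtain y where y: "y \<in> col S T s" "y \<noteq> x" by blast
  have yX: "y \<in> X s" using y unfolding col_def by auto
  have only: "\<not> (A b x z \<and> A b y z)" if "z \<in> X w" for z using A_left_unique[OF x(1) yX that] y(2) by blast
  \<comment> \<open>In \<open>t\<close> the token on \<open>w\<close> is touched by
    \<open>x\<close>, in \<open>t'\<close> by \<open>y\<close>; the matching forbids both at
    once.\<close>
  obtain t' where t': "(s, t') \<in> T" "A b y (t' w)"
    using col_attained[OF sl(1,3,2) b sS _ y(1)] w by blast
  have "\<not> A b y (t w)" "\<not> A b x (t' w)"
    using only[of "t w"] only[of "t' w"] token_in[OF sl(1), of s _ w] t t' wne x by auto
  moreover have "deg C b s t x = deg C b s t y" "deg C b s t' x = deg C b s t' y"
    using key[OF t] key[OF t'(1)] xc y(1) by blast+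
  ultimately have "deg S b s t x = deg S b s t y + 1" "deg S b s t' y = deg S b s t' x + 1"
    using split[OF t x(1)] split[OF t yX] split[OF t'(1) x(1)] split[OF t'(1) yX] x(2) t'(2) by simp_all
  then show False using deg_invariant[OF sl(1) t t'(1) x(1), of b] deg_invariant[OF sl(1) t t'(1) yX, of b] by simp
qed

end

section \<open>Induced cycles, as enumerations in which only cyclically consecutive vertices are
  adjacent\<close>

definition cycle_enum :: "('v \<Rightarrow> 'v \<Rightarrow> bool) \<Rightarrow> nat \<Rightarrow> (nat \<Rightarrow> 'v) \<Rightarrow> 'v set \<Rightarrow> bool" where
  "cycle_enum E n c C \<longleftrightarrow> 3 \<le> n \<and> bij_betw c {..<n} C \<and>
     (\<forall>i<n. \<forall>j<n. E (c i) (c j) \<longleftrightarrow> j = (i + 1) mod n \<or> i = (j + 1) mod n)"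

lemma cycle_enum_neighbours:
  assumes "cycle_enum E n c C" "v \<in> C"
  obtains p q where "p \<in> C" "q \<in> C" "p \<noteq> q" "p \<noteq> v" "q \<noteq> v" "\<And>u. u \<in> C \<Longrightarrow> E v u \<longleftrightarrow> u = p \<or> u = q"
    "n \<ge> 4 \<Longrightarrow> \<not> E p q"
proof -
  have n: "3 \<le> n" and bij: "bij_betw c {..<n} C" using assms unfolding cycle_enum_def by auto
  have adj: "E (c i) (c j) \<longleftrightarrow> j = (i + 1) mod n \<or> i = (j + 1) mod n" if "i < n" "j < n" for i j
    using assms that unfolding cycle_enum_def by blast
  obtain i where i: "i < n" "v = c i" using bij assms(2) unfolding bij_betw_def by auto
  define j where "j = (i + 1) mod n"
  \<comment> \<open>The cyclic predecessor; subtraction on naturals would stick at 0.\<close>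
  define k where "k = (if i = 0 then n - 1 else i - 1)"
  have j: "j = (if i = n - 1 then 0 else i + 1)" unfolding j_def using i by (auto simp: mod_Suc)
  have jk: "j < n" "k < n" "j \<noteq> k" "j \<noteq> i" "k \<noteq> i" using i n unfolding j k_def by (auto split: if_splits)
  have k1: "i = (l + 1) mod n \<longleftrightarrow> l = k" if "l < n" for l
    using that i n unfolding k_def by (auto simp: mod_Suc)
  have inj: "c a = c b \<longleftrightarrow> a = b" if "a < n" "b < n" for a b
    using bij that unfolding bij_betw_def inj_on_def by auto
  have "c j \<in> C" "c k \<in> C" "c j \<noteq> c k" "c j \<noteq> v" "c k \<noteq> v"
    using bij jk i inj unfolding bij_betw_def by auto
  moreover have "E v u \<longleftrightarrow> u = c j \<or> u = c k" if uC: "u \<in> C" for u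
  proof -
    obtain l where l: "l < n" "u = c l" using bij uC unfolding bij_betw_def by auto
    then show ?thesis using adj[OF i(1) l(1)] k1[OF l(1)] inj jk i unfolding j_def by auto
  qed
  moreover have "\<not> E (c j) (c k)" if "n \<ge> 4"
    unfolding adj[OF jk(1,2)] using that i unfolding j k_def by (auto simp: mod_Suc split: if_splits)
  ultimately show thesis using that by blast
qed

lemma cycle_enum_biconn:
  assumes sym: "symp E" and c: "cycle_enum E n c C"
  shows "biconn E C"
proof -
  have n: "3 \<le> n" and bij: "bij_betw c {..<n} C" using c unfolding cycle_enum_def by auto
  have img: "c ` {..<n} = C" and inj: "inj_on c {..<n}" using bij unfolding bij_betw_def by auto
  have adj: "E (c i) (c j) \<longleftrightarrow> j = (i + 1) mod n \<or> i = (j + 1) mod n" if "i < n" "j < n" for i j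
    using c that unfolding cycle_enum_def by blast
  \<comment> \<open>Segments of the enumeration are paths. A cycle minus a vertex consists of two
    segments, joined by the edge from \<open>n - 1\<close> to 0.\<close>
  have seg: "conn E (c ` {a..<b})" if "b \<le> n" for a b
    using that
  proof (induction b)
    case (Suc b)
    show ?case
    proof (cases "a < b")
      case True
      then obtain b' where b': "b = Suc b'" "a \<le> b'" by (cases b) auto
      have "{a..<Suc b} = insert b {a..<b}" using True by auto
      moreover have "conn E (insert (c b) (c ` {a..<b}))"
        by (rule conn_insert[OF sym _ _, of _ "c b'"]) (use Suc b' adj[of b' b] in auto)
      ultimately show ?thesis by simp
    next
      case False
      then have "{a..<Suc b} = {} \<or> {a..<Suc b} = {b}" by auto
      then show ?thesis by auto
    qed
  qed simp
  have "conn E (C - {v})" if "v \<in> C" for v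
  proof -
    obtain i where i: "i < n" "v = c i" using img \<open>v \<in> C\<close> by auto
    have eq: "C - {v} = c ` {Suc i..<n} \<union> c ` {0..<i}"
    proof -
      have "C - {v} = c ` ({..<n} - {i})" using inj i img by (auto simp: inj_on_def)
      moreover have "{..<n} - {i} = {Suc i..<n} \<union> {0..<i}" using i by auto
      ultimately show ?thesis by (simp add: image_Un)
    qed
    have conn1: "conn E (c ` {Suc i..<n})" "conn E (c ` {0..<i})" using seg i by auto
    consider "i = 0" | "i = n - 1" | "0 < i" "i < n - 1" using i by linarith
    then show ?thesis
    proof cases
      case 3
      show ?thesis unfolding eq
      proof (rule conn_Un[OF sym conn1, of "c (n - 1)" "c 0"])
        show "c (n - 1) = c 0 \<or> E (c (n - 1)) (c 0)" using adj[of "n - 1" 0] n by auto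
      qed (use 3 in auto)
    next
      case 1
      then show ?thesis using conn1(1) unfolding eq by simp
    next
      case 2
      then have "{Suc i..<n} = {}" by auto
      then show ?thesis using conn1(2) unfolding eq by simp
    qed
  qed
  moreover have "conn E C" using seg[of n 0] img by (simp add: atLeast0LessThan)
  ultimately show ?thesis unfolding biconn_def by blast
qed

lemma cycle_enum_card: "cycle_enum E n c C \<Longrightarrow> card C = n"
  unfolding cycle_enum_def using bij_betw_same_card by fastforce

text \<open>
  Joining two neighbours of \<open>v\<close> by a shortest walk in \<open>V\<close>, the pair being chosen such that
  no inner vertex could replace one of them, gives an induced cycle through \<open>v\<close>.
\<close>

lemma induced_cycle_through:
  assumes sym: "symp E" and irr: "\<And>v. \<not> E v v" and "conn E V" "v \<notin> V"
    and pair: "u \<in> V" "w \<in> V" "E v u" "E v w" "Q u w" "u \<noteq> w"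
    and Q: "\<And>u w z. z \<in> V \<Longrightarrow> E v u \<Longrightarrow> E v w \<Longrightarrow> E v z \<Longrightarrow> Q u w \<Longrightarrow> z \<noteq> u \<Longrightarrow> z \<noteq> w \<Longrightarrow> Q u z \<or> Q z w"
  obtains n c C a b where "cycle_enum E n c C" "C \<subseteq> insert v V" "v \<in> C" "a \<in> C" "b \<in> C"
    "E v a" "E v b" "a \<noteq> b" "Q a b"
proof -
  define walk where "walk p k \<longleftrightarrow> (\<forall>i\<le>k. p i \<in> V) \<and> (\<forall>i<k. E (p i) (p (Suc i)))" for p k
  define ok where "ok p k \<longleftrightarrow> walk p k \<and> E v (p 0) \<and> E v (p k) \<and> p 0 \<noteq> p k \<and> Q (p 0) (p k)" for p k
  have "\<exists>p k. walk p k \<and> p 0 = u \<and> p k = w"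
  proof (rule conn_induct[OF \<open>conn E V\<close> pair(1,2)])
    show "\<exists>p k. walk p k \<and> p 0 = u \<and> p k = u"
      by (rule exI[of _ "\<lambda>_. u"], rule exI[of _ 0]) (use pair in \<open>auto simp: walk_def\<close>)
  next
    fix a b assume ab: "a \<in> V" "b \<in> V" "\<exists>p k. walk p k \<and> p 0 = u \<and> p k = a" "E a b"
    then obtain p k where p: "walk p k" "p 0 = u" "p k = a" by blast
    have "walk (p(Suc k := b)) (Suc k)" using p ab unfolding walk_def by (auto simp: less_Suc_eq le_Suc_eq)
    then show "\<exists>p k. walk p k \<and> p 0 = u \<and> p k = b"
      using p by (intro exI[of _ "p(Suc k := b)"] exI[of _ "Suc k"]) auto
  qed
  then have ex: "\<exists>k p. ok p k" unfolding ok_def using pair by blast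
  \<comment> \<open>The least length over all admissible pairs of ends at once, not for a fixed
    pair.\<close>
  define k where "k = (LEAST k. \<exists>p. ok p k)"
  obtain p where p: "ok p k" using LeastI_ex[OF ex] unfolding k_def by blast
  have min: "\<not> ok p' k'" if "k' < k" for p' k' using not_less_Least that unfolding k_def by blast
  have pV: "p i \<in> V" if "i \<le> k" for i using p that unfolding ok_def walk_def by blast
  have pE: "E (p i) (p (Suc i))" if "i < k" for i using p that unfolding ok_def walk_def by blast
  have k1: "1 \<le> k" using p unfolding ok_def by (cases k) auto
  have short: False if ij: "i < j" "j \<le> k" and st: "p i = p j \<or> E (p i) (p j) \<and> Suc i < j" for i j
  proof -
    \<comment> \<open>The number of steps saved: if \<open>p i = p j\<close>, the loop between them
      is cut out and \<open>p'\<close> jumps at index \<open>i\<close> itself; otherwise the chord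
      replaces the detour and the jump comes just after \<open>i\<close>.\<close>
    define d where "d = (if p i = p j then j - i else j - i - 1)"
    define p' where "p' l = (if l \<le> i \<and> (l < i \<or> p i \<noteq> p j) then p l else p (l + d))" for l
    have d: "0 < d" "d \<le> k - i" using ij st unfolding d_def by auto
    have "walk p' (k - d)" unfolding walk_def
    proof (intro conjI allI impI)
      fix l assume "l \<le> k - d" then show "p' l \<in> V" using pV ij d unfolding p'_def by auto
    next
      fix l assume l: "l < k - d"
      consider "Suc l \<le> i \<and> (Suc l < i \<or> p i \<noteq> p j)" | "Suc l = i" "p i = p j"
        | "l = i" "p i \<noteq> p j" | "i \<le> l" "l \<noteq> i \<or> p i = p j" by linarith
      then show "E (p' l) (p' (Suc l))"
      proof cases
        case 1 then show ?thesis using pE[of l] ij unfolding p'_def by auto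
      next
        case 2 then show ?thesis using pE[of l] ij unfolding p'_def d_def by auto
      next
        case 3 then show ?thesis using st ij unfolding p'_def d_def by auto
      next
        case 4 then show ?thesis using pE[of "l + d"] l ij unfolding p'_def by auto
      qed
    qed
    moreover have "p' 0 = p 0" using ij unfolding p'_def d_def by auto
    moreover have "p' (k - d) = p k"
    proof (cases "p i = p j")
      case True
      then show ?thesis using ij d unfolding p'_def d_def by auto
    next
      case False
      then show ?thesis using ij d st unfolding p'_def d_def by auto
    qed
    ultimately have "ok p' (k - d)" using p unfolding ok_def by auto
    then show False using min[of "k - d"] d k1 by auto
  qed
  have inj: "p i = p j \<longleftrightarrow> i = j" if "i \<le> k" "j \<le> k" for i j
    using short[of i j] short[of j i] that by (metis linorder_neqE_nat)
  \<comment> \<open>By the exchange property of \<open>Q\<close>, an inner neighbour of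
    \<open>v\<close> could replace one of the ends, and the walk would get shorter.\<close>
  have inner: "\<not> E v (p i)" if "0 < i" "i < k" for i
  proof
    assume Ei: "E v (p i)"
    have ne: "p i \<noteq> p 0" "p i \<noteq> p k" using inj[of i 0] inj[of i k] that by auto
    have "Q (p 0) (p i) \<or> Q (p i) (p k)" using Q[of "p i" "p 0" "p k"] p Ei ne pV[OF less_imp_le[OF that(2)]] unfolding ok_def by blast
    then show False
    proof
      assume "Q (p 0) (p i)"
      then have "ok p i" using p Ei ne that unfolding ok_def walk_def by auto
      then show False using min that by blast
    next
      assume "Q (p i) (p k)"
      then have "ok (\<lambda>l. p (l + i)) (k - i)" using p Ei ne that unfolding ok_def walk_def by auto
      then show False using min[of "k - i"] that by auto
    qed
  qed
  have pp: "E (p i) (p j) \<longleftrightarrow> j = Suc i \<or> i = Suc j" if ij: "i \<le> k" "j \<le> k" for i j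
  proof
    assume e: "E (p i) (p j)"
    then have "i \<noteq> j" using irr by auto
    then consider "i < j" | "j < i" by linarith
    then show "j = Suc i \<or> i = Suc j"
    proof cases
      case 1 then show ?thesis using short[of i j] ij e Suc_lessI[of i j] by blast
    next
      case 2 then show ?thesis using short[of j i] ij sympD[OF sym e] Suc_lessI[of j i] by blast
    qed
  next
    assume "j = Suc i \<or> i = Suc j"
    then show "E (p i) (p j)" using pE[of i] pE[of j] sympD[OF sym, of "p j" "p i"] ij by auto
  qed
  have vp: "E v (p i) \<longleftrightarrow> i = 0 \<or> i = k" if "i \<le> k" for i
    using inner[of i] that p unfolding ok_def by (metis le_neq_implies_less neq0_conv)
  \<comment> \<open>The vertices \<open>p 0\<close> to \<open>p k\<close>, followed by
    \<open>v\<close>; \<open>k\<close> is at least 1, so the length is at least 3.\<close>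
  define n where "n = k + 2"
  define c where "c i = (if i \<le> k then p i else v)" for i
  define C where "C = insert v (p ` {..k})"
  have split: "{..<n} = insert (Suc k) {..k}" unfolding n_def by auto
  have img: "c ` {..<n} = C" unfolding split C_def c_def by auto
  have injc: "inj_on c {..<n}" unfolding inj_on_def split
  proof (intro ballI impI)
    fix x y assume "x \<in> insert (Suc k) {..k}" "y \<in> insert (Suc k) {..k}" "c x = c y"
    then show "x = y" using inj[of x y] pV[of x] pV[of y] \<open>v \<notin> V\<close> unfolding c_def by (auto split: if_splits)
  qed
  have adj: "E (c i) (c j) \<longleftrightarrow> j = (i + 1) mod n \<or> i = (j + 1) mod n" if ij: "i < n" "j < n" for i j
  proof -
    have pv: "E (p i) v \<longleftrightarrow> i = 0 \<or> i = k" if "i \<le> k" for i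
      using vp[OF that] sympD[OF sym, of v "p i"] sympD[OF sym, of "p i" v] by blast
    have md: "(l + 1) mod n = (if l = Suc k then 0 else Suc l)" if "l < n" for l
      using that unfolding n_def by auto
    consider "i \<le> k" "j \<le> k" | "i \<le> k" "j = Suc k" | "i = Suc k" "j \<le> k" | "i = Suc k" "j = Suc k"
      using ij unfolding n_def by linarith
    then show ?thesis
    proof cases
      case 1 then show ?thesis unfolding md[OF ij(1)] md[OF ij(2)] c_def using pp[OF 1] by auto
    next
      case 2 then show ?thesis unfolding md[OF ij(1)] md[OF ij(2)] c_def using pv[of i] by auto
    next
      case 3 then show ?thesis unfolding md[OF ij(1)] md[OF ij(2)] c_def using vp[of j] by auto
    next
      case 4 then show ?thesis unfolding md[OF ij(1)] md[OF ij(2)] c_def using irr[of v] by auto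
    qed
  qed
  have "cycle_enum E n c C"
    unfolding cycle_enum_def bij_betw_def using k1 injc img adj unfolding n_def by auto
  moreover have "C \<subseteq> insert v V" "v \<in> C" "p 0 \<in> C" "p k \<in> C" unfolding C_def using pV by auto
  ultimately show thesis using that[of n c C "p 0" "p k"] p unfolding ok_def by blast
qed

lemma biconn_insert:
  assumes sym: "symp E" and "biconn E S" "a \<in> S" "b \<in> S" "a \<noteq> b" "E a x" "E b x" "x \<notin> S"
  shows "biconn E (insert x S)"
proof -
  have "conn E (insert x S - {v})" if v: "v \<in> insert x S" for v
  proof (cases "v = x")
    case True
    then show ?thesis using assms unfolding biconn_def by simp
  next
    case False
    then have "conn E (S - {v})" using v assms unfolding biconn_def by simp
    moreover obtain c where "c \<in> S - {v}" "E c x" using assms by (cases "v = a") auto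
    ultimately have "conn E (insert x (S - {v}))" using conn_insert[OF sym] by blast
    moreover have "insert x S - {v} = insert x (S - {v})" using False by auto
    ultimately show ?thesis by simp
  qed
  moreover have "conn E (insert x S)" using conn_insert[OF sym] assms unfolding biconn_def by blast
  ultimately show ?thesis unfolding biconn_def by blast
qed

section \<open>Subsets that keep two active colours\<close>

context token_system
begin

text \<open>
  With the tokens outside \<open>C\<close> frozen in a suitable way, the vertices of \<open>C\<close> have more than one
  active colour.
\<close>

definition good :: "'v set \<Rightarrow> ('v \<times> ('v \<Rightarrow> 'c)) set \<Rightarrow> 'v set \<Rightarrow> bool" where
  "good S T C \<longleftrightarrow> (\<exists>v t. (v, t) \<in> T \<and> v \<in> C \<and> 2 \<le> card (col C (restr S C T t) v))"

lemma goodI: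
  assumes "(v, t) \<in> T" "v \<in> C" "x \<in> X v" "y \<in> X v" "x \<noteq> y"
    and "a \<in> C - {v}" "A d x (t a)" "b \<in> C - {v}" "A e y (t b)"
  shows "good S T C"
proof -
  have "(v, t) \<in> restr S C T t" using restr_self assms by blast
  then have "{x, y} \<subseteq> col C (restr S C T t) v"
    using colI[of v t _ x a C d] colI[of v t _ y b C e] assms by simp
  then have "card {x, y} \<le> card (col C (restr S C T t) v)" by (rule card_mono[OF finite_col])
  then have "2 \<le> card (col C (restr S C T t) v)" using assms(5) by simp
  then show ?thesis using assms(1,2) unfolding good_def by blast
qed

context
  fixes B T assumes sliding: "sliding B T"
begin

text \<open>The witness sits at one vertex; constancy of the count spreads it over
  \<open>C\<close>.\<close>

lemma goodE:
  assumes "good B T C" "C \<subseteq> B" "biconn E C"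
  obtains t0 where "sliding C (restr B C T t0)" "restr B C T t0 \<noteq> {}"
    "\<And>w. w \<in> C \<Longrightarrow> 2 \<le> card (col C (restr B C T t0) w)"
proof -
  obtain v t where v: "(v, t) \<in> T" "v \<in> C" "2 \<le> card (col C (restr B C T t) v)"
    using assms unfolding good_def by blast
  have 1: "sliding C (restr B C T t)" using restr_sliding[OF sliding assms(2)] .
  have 2: "restr B C T t \<noteq> {}" using restr_self[OF v(1,2)] by auto
  have "2 \<le> card (col C (restr B C T t) w)" if "w \<in> C" for w
    using card_col[OF 1 assms(3) 2 v(2) that] v(3) by simp
  then show thesis using that[of t] 1 2 by blast
qed

text \<open>Freezing fewer tokens of the same configuration loses no active colour.\<close>

lemma good_mono:
  assumes "good B T C" "C \<subseteq> C'" "C' \<subseteq> B"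
  shows "good B T C'"
proof -
  obtain v t where v: "(v, t) \<in> T" "v \<in> C" "2 \<le> card (col C (restr B C T t) v)"
    using assms unfolding good_def by blast
  have "restr B C T t \<subseteq> restr B C' T t" using assms unfolding restr_def by auto
  then have "col C (restr B C T t) v \<subseteq> col C' (restr B C' T t) v"
    using assms(2) unfolding col_def by blast
  then have "card (col C (restr B C T t) v) \<le> card (col C' (restr B C' T t) v)"
    by (rule card_mono[OF finite_col])
  then have "2 \<le> card (col C' (restr B C' T t) v)" using v(3) by simp
  then show ?thesis using v assms(2) unfolding good_def by blast
qed

lemma good_two_neighbours:
  assumes "good B T C" "C \<subseteq> B" "biconn E C" "v \<in> C" "p \<in> C" "q \<in> C" "p \<noteq> q"
    and "\<And>u. u \<in> C \<Longrightarrow> E v u \<longleftrightarrow> u = p \<or> u = q"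
  shows "R b v p \<longleftrightarrow> R b v q"
proof -
  obtain t0 where t0: "sliding C (restr B C T t0)" "restr B C T t0 \<noteq> {}"
    "\<And>w. w \<in> C \<Longrightarrow> 2 \<le> card (col C (restr B C T t0) w)"
    using goodE[OF assms(1-3)] by blast
  show ?thesis using two_neighbours(1)[OF t0(1) assms(3) t0(2) assms(4-8) t0(3)[OF assms(4)]] .
qed

text \<open>The way down to smaller sets: everything that the colours of \<open>c\<close> touch lies
  in \<open>S'\<close>, so they remain active there.\<close>

lemma good_neighbourhood:
  assumes "good B T S" "S \<subseteq> B" "biconn E S" "S' \<subseteq> S" "c \<in> S'" "\<And>u. u \<in> S - S' \<Longrightarrow> \<not> E c u"
  shows "good B T S'"
proof -
  obtain t0 where t0: "sliding S (restr B S T t0)" "restr B S T t0 \<noteq> {}"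
    "\<And>w. w \<in> S \<Longrightarrow> 2 \<le> card (col S (restr B S T t0) w)"
    using goodE[OF assms(1-3)] by blast
  have cS: "c \<in> S" using assms by blast
  obtain t where t: "(c, t) \<in> restr B S T t0"
    using exists_hole[OF t0(1) _ t0(2) cS] assms(3) unfolding biconn_def by blast
  have tT: "(c, t) \<in> T" using t unfolding restr_def by blast
  have "col S (restr B S T t0) c \<subseteq> col S' (restr B S' T t) c"
  proof
    fix x assume x: "x \<in> col S (restr B S T t0) c"
    then have xX: "x \<in> X c" unfolding col_def by blast
    obtain b u where u: "u \<in> S - {c}" "A b x (t u)" using col_adjacent[OF t0(1) x t] by blast
    have "E c u" using A_imp_E[of x c "t u" u b] xX u token_in[OF t0(1) t, of u] by simp
    then have "u \<in> S'" using assms u by blast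
    then show "x \<in> col S' (restr B S' T t) c"
      using colI[of c t _ x u S' b] restr_self[OF tT assms(5)] xX u by simp
  qed
  then have "card (col S (restr B S T t0) c) \<le> card (col S' (restr B S' T t) c)"
    by (rule card_mono[OF finite_col])
  then have "2 \<le> card (col S' (restr B S' T t) c)" using t0(3)[OF cS] by simp
  then show ?thesis using tT assms(5) unfolding good_def by blast
qed

lemma good_unbalanced_split_False:
  assumes "good B T C" "C \<subseteq> S" "S \<subseteq> B" "biconn E S" "biconn E C"
    and "c \<in> C" "\<And>u. u \<in> S - C \<Longrightarrow> \<not> E c u"
    and "s \<in> C" "p \<in> C" "q \<in> C" "p \<noteq> q" "\<And>u. u \<in> C \<Longrightarrow> E s u \<longleftrightarrow> u = p \<or> u = q"
    and "w \<in> S - C" "\<And>u. u \<in> S - C \<Longrightarrow> E s u \<longleftrightarrow> u = w"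
  shows False
proof -
  obtain t0 where t0: "sliding S (restr B S T t0)" "restr B S T t0 \<noteq> {}"
    "\<And>w. w \<in> S \<Longrightarrow> 2 \<le> card (col S (restr B S T t0) w)"
    using goodE[OF good_mono[OF assms(1,2,3)] assms(3,4)] by blast
  have "c \<in> S" using assms by blast
  then show ?thesis
    using unbalanced_split_False[OF t0(1,2) assms(4,2,5,6,7) t0(3) assms(8-12) assms(13,14)] by blast
qed

text \<open>In the direction \<open>d\<close> of an arc from \<open>a\<close> to \<open>w\<close>,
  the vertex \<open>a\<close> has arcs to all three others, shared by at least two active colours;
  so some colour \<open>x\<close> has degree 1. When its only contact is on \<open>w\<close>,
  another colour must cover \<open>b\<close>, and both are active on
  \<open>{a, b, w}\<close>.\<close>

lemma good_triangle_exchange: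
  assumes "good B T {a, b, c}" "{a, b, c, w} \<subseteq> B"
    and dist: "a \<noteq> b" "a \<noteq> c" "b \<noteq> c" "w \<noteq> a" "w \<noteq> b" "w \<noteq> c"
    and adj: "E a b" "E a c" "E b c" "E a w" "E b w" "E c w"
  shows "good B T {a, b, w}"
proof -
  let ?S = "{a, b, c, w}"
  have bicC: "biconn E {a, b, c}" and bicS: "biconn E ?S"
    by (rule biconn_clique; use adj E_sym in blast)+
  have sub: "{a, b, c} \<subseteq> B" using assms(2) by blast
  have bc: "R d a b \<longleftrightarrow> R d a c" for d
    by (rule good_two_neighbours[OF assms(1) sub bicC]) (use dist adj in auto)
  obtain t0 where t0: "sliding ?S (restr B ?S T t0)" "restr B ?S T t0 \<noteq> {}"
    "\<And>w. w \<in> ?S \<Longrightarrow> 2 \<le> card (col ?S (restr B ?S T t0) w)"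
    using goodE[OF good_mono[OF assms(1) _ assms(2)] assms(2) bicS] by blast
  let ?T = "restr B ?S T t0"
  obtain d where d: "R d a w" using adj(4) unfolding E_def by blast
  have two: "2 \<le> card (col ?S ?T a)" using t0(3)[of a] by simp
  have le: "card (col ?S ?T a) \<le> card {u \<in> ?S. R d a u}"
    using card_col_le_degree[OF t0(1) bicS t0(2) d] by simp
  \<comment> \<open>The arc to \<open>w\<close> alone is too little for two active colours; a
    further one goes to \<open>b\<close> or \<open>c\<close>, and then to both.\<close>
  have ab: "R d a b"
  proof (rule ccontr)
    assume "\<not> R d a b"
    then have "{u \<in> ?S. R d a u} \<subseteq> {w}" using bc R_irrefl by auto
    then have "card {u \<in> ?S. R d a u} \<le> 1" using card_mono[of "{w}"] by fastforce
    then show False using le two by simp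
  qed
  have "{u \<in> ?S. R d a u} = {b, c, w}" using ab bc d R_irrefl by auto
  then have three: "card {u \<in> ?S. R d a u} = 3" using dist by simp
  obtain t1 where t1: "(a, t1) \<in> ?T"
    using exists_hole[OF t0(1) _ t0(2), of a] bicS unfolding biconn_def by blast
  \<comment> \<open>Of three arcs, two or more colours cannot take two each.\<close>
  have "\<exists>x\<in>col ?S ?T a. deg ?S d a t1 x = 1"
  proof (rule ccontr)
    assume no: "\<not> ?thesis"
    have "2 \<le> deg ?S d a t1 x" if x: "x \<in> col ?S ?T a" for x
      using deg_ge_1[OF t0(1) bicS t0(2) d _ _ x t1] no x by force
    then have "(\<Sum>x\<in>col ?S ?T a. 2) \<le> (\<Sum>x\<in>col ?S ?T a. deg ?S d a t1 x)" by (intro sum_mono)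
    then show False using sum_deg[OF t0(1) t1, of d] three two by simp
  qed
  then obtain x where x: "x \<in> col ?S ?T a" "deg ?S d a t1 x = 1" by blast
  have xX: "x \<in> X a" using x unfolding col_def by blast
  obtain t where t: "(a, t) \<in> ?T" "A d x (t w)"
    using col_attained[OF t0(1) bicS t0(2) d _ _ x(1)] by auto
  have one: "deg ?S d a t x = 1" using deg_invariant[OF t0(1) t1 t(1) xX] x by simp
  obtain y where y: "y \<in> X a" "A d y (t b)" using covered[OF t0(1) t(1) _ ab] by auto
  have "x \<noteq> y"
  proof
    assume "x = y"
    then have "{b, w} \<subseteq> {u \<in> ?S - {a}. A d x (t u)}" using y t dist by auto
    then have "card {b, w} \<le> deg ?S d a t x" unfolding deg_def by (rule card_mono[rotated]) simp
    then show False using one dist by simp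
  qed
  moreover have "(a, t) \<in> T" using t unfolding restr_def by blast
  ultimately show ?thesis
    using goodI[of a t T "{a, b, w}" x y w d b d B] xX y t dist by simp
qed

text \<open>In the wheel all neighbours of \<open>v\<close> lie in \<open>{p, v, w, q}\<close>, and
  as the cycle has length at least 4, \<open>p\<close> misses \<open>q\<close>. So two colours
  survive first on these four vertices and then on the triangle \<open>{p, v, w}\<close>. But
  \<open>q\<close> touches \<open>v\<close> and not \<open>p\<close>, an unbalanced split of that
  triangle.\<close>

lemma good_cycle_dominated_False:
  assumes "good B T C" "C \<subseteq> B" "cycle_enum E n c C" "4 \<le> n" "w \<in> B - C" "\<And>v. v \<in> C \<Longrightarrow> E v w"
  shows False
proof -
  have bicC: "biconn E C" using cycle_enum_biconn[OF symp_E assms(3)] .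
  obtain v where v: "v \<in> C" using assms(3,4) unfolding cycle_enum_def bij_betw_def by fastforce
  obtain p q where pq: "p \<in> C" "q \<in> C" "p \<noteq> q" "p \<noteq> v" "q \<noteq> v"
    "\<And>u. u \<in> C \<Longrightarrow> E v u \<longleftrightarrow> u = p \<or> u = q" "\<not> E p q"
    using cycle_enum_neighbours[OF assms(3) v] assms(4) by metis
  have adj: "E v p" "E v q" "E p v" "E q v" "E v w" "E p w" "E q w" "E w v" "E w p" "E w q"
    using pq(6)[OF pq(1)] pq(6)[OF pq(2)] assms(6)[OF v] assms(6)[OF pq(1)] assms(6)[OF pq(2)] E_sym by auto
  have ne: "w \<noteq> v" "w \<noteq> p" "w \<noteq> q" using assms(5) v pq by auto
  have bicS: "biconn E (insert w C)"
    by (rule biconn_insert[OF symp_E bicC pq(1,2,3)]) (use adj assms in auto)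
  have goodS: "good B T (insert w C)" using good_mono[OF assms(1)] assms(2,5) by blast
  have bic': "biconn E {p, v, w}" by (rule biconn_clique) (use adj in auto)
  have "biconn E (insert q {p, v, w})"
    by (rule biconn_insert[OF symp_E bic', of v w]) (use adj pq ne in auto)
  moreover have "insert q {p, v, w} = {p, v, w, q}" by auto
  ultimately have bicS': "biconn E {p, v, w, q}" by simp
  have "good B T {p, v, w, q}"
    by (rule good_neighbourhood[OF goodS _ bicS, of _ v]) (use assms(2,5) pq v in auto)
  then have "good B T {p, v, w}"
    by (rule good_neighbourhood[OF _ _ bicS', of _ p]) (use assms(2,5) pq v adj ne in auto)
  then show False
    by (rule good_unbalanced_split_False[OF _ _ _ bicS' bic', of p v p w q])
      (use assms(2,5) pq v adj ne in auto)
qed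

end

end

section \<open>Two or more active colours: a bidirected clique or a cycle\<close>

context token_system
begin

context
  fixes B T assumes sliding: "sliding B T" and bic: "biconn E B"
begin

text \<open>A cycle through \<open>v\<close> suffices if its tokens next to \<open>v\<close> touch
  two colours of \<open>v\<close>. \<open>Q u w\<close> says that \<open>u\<close> and
  \<open>w\<close> together do so. As every neighbour of \<open>v\<close> touches some colour, it
  can replace \<open>u\<close> or \<open>w\<close>, which is the exchange property that
  \<open>induced_cycle_through\<close> asks for.\<close>

lemma good_cycle_exists:
  assumes "3 \<le> card B" "(v, t) \<in> T" "2 \<le> card (col B T v)"
  obtains n c C where "cycle_enum E n c C" "C \<subseteq> B" "good B T C"
proof -
  define cols where "cols u = {x \<in> X v. \<exists>b. A b x (t u)}" for u
  define Q where "Q u w \<longleftrightarrow> (\<exists>x\<in>cols u \<union> cols w. \<exists>y\<in>cols u \<union> cols w. x \<noteq> y)" for u w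
  have QI: "Q a b" if "x \<in> cols a \<union> cols b" "y \<in> cols a \<union> cols b" "x \<noteq> y" for x a b y
    using that unfolding Q_def by blast
  have vB: "v \<in> B" using hole_in[OF sliding assms(2)] .
  obtain x y where xy: "x \<in> col B T v" "y \<in> col B T v" "x \<noteq> y"
  proof -
    have "\<not> card (col B T v) \<le> Suc 0" using assms(3) by simp
    then show thesis using card_le_Suc0_iff_eq[OF finite_col] that by blast
  qed
  have ex: "\<exists>u\<in>B - {v}. z \<in> cols u \<and> E v u" if z: "z \<in> col B T v" for z
  proof -
    have zX: "z \<in> X v" using z unfolding col_def by blast
    obtain b u where u: "u \<in> B - {v}" "A b z (t u)" using col_adjacent[OF sliding z assms(2)] by blast
    then have "E v u" using A_imp_E[of z v "t u" u b] zX token_in[OF sliding assms(2), of u] by simp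
    then show ?thesis using u zX unfolding cols_def by blast
  qed
  obtain u where u: "u \<in> B - {v}" "x \<in> cols u" "E v u" using ex[OF xy(1)] by blast
  obtain u' where u': "u' \<in> B - {v}" "y \<in> cols u'" "E v u'" using ex[OF xy(2)] by blast
  have "\<exists>w\<in>B - {v}. E v w \<and> u \<noteq> w \<and> Q u w"
  proof (cases "u = u'")
    case False
    then show ?thesis using u u' xy unfolding Q_def by blast
  next
    \<comment> \<open>One neighbour may touch both colours, in different directions. Any other
      neighbour completes the pair, and \<open>B - {u}\<close> being connected provides one.\<close>
    case True
    have "B - {u} \<noteq> {v}"
    proof
      assume "B - {u} = {v}"
      then have "B = {u, v}" using u by auto
      then have "card B \<le> 2" by (simp add: card_insert_if)
      then show False using assms(1) by simp
    qed
    then obtain a w where "a \<in> {v}" "w \<in> B - {u} - {v}" "E a w"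
      using conn_crossing[of E "B - {u}" "{v}"] bic u vB unfolding biconn_def by auto
    then show ?thesis using u u' xy True unfolding Q_def by (intro bexI[of _ w]) auto
  qed
  then obtain w where w: "w \<in> B - {v}" "E v w" "u \<noteq> w" "Q u w" by blast
  have cne: "cols z \<noteq> {}" if z: "z \<in> B - {v}" "E v z" for z
  proof -
    obtain b where "R b v z" using z(2) unfolding E_def by blast
    then show ?thesis using covered[OF sliding assms(2), of z b] z unfolding cols_def by blast
  qed
  have conn: "conn E (B - {v})" using bic vB unfolding biconn_def by blast
  have Q: "Q a z \<or> Q z b" if z: "z \<in> B - {v}" "E v z" "Q a b" for a b z
  proof -
    obtain e where e: "e \<in> cols z" using cne[OF z(1,2)] by blast
    obtain x y where "x \<in> cols a \<union> cols b" "y \<in> cols a \<union> cols b" "x \<noteq> y"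
      using z(3) unfolding Q_def by blast
    then consider "x \<in> cols a" "y \<in> cols a" | "x \<in> cols b" "y \<in> cols b"
      | "x \<in> cols a" "y \<in> cols b" | "y \<in> cols a" "x \<in> cols b" by blast
    then show ?thesis
    proof cases
      case 3
      then show ?thesis using QI[of x a z e] QI[of e z b y] e \<open>x \<noteq> y\<close> by auto
    next
      case 4
      then show ?thesis using QI[of y a z e] QI[of e z b x] e \<open>x \<noteq> y\<close> by auto
    qed (use QI[of x a z y] QI[of x z b y] \<open>x \<noteq> y\<close> in auto)
  qed
  obtain n c C a b where C: "cycle_enum E n c C" "C \<subseteq> insert v (B - {v})" "v \<in> C" "a \<in> C" "b \<in> C"
    "E v a" "E v b" "a \<noteq> b" "Q a b"
    by (rule induced_cycle_through[where Q = Q and E = E and V = "B - {v}" and v = v and u = u and w = w,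
          OF symp_E E_irrefl conn _ u(1) w(1) u(3) w(2,4,3)]) (use Q in auto)
  obtain x' y' where xy': "x' \<in> cols a \<union> cols b" "y' \<in> cols a \<union> cols b" "x' \<noteq> y'"
    using C(9) unfolding Q_def by blast
  have ab: "a \<noteq> v" "b \<noteq> v" using C by auto
  obtain a' d where a': "a' \<in> C - {v}" "A d x' (t a')" "x' \<in> X v"
    using xy'(1) C(4,5) ab unfolding cols_def by blast
  obtain b' e where b': "b' \<in> C - {v}" "A e y' (t b')" "y' \<in> X v"
    using xy'(2) C(4,5) ab unfolding cols_def by blast
  have "good B T C" using goodI[of v t T C x' y' a' d b' e B] assms(2) C(3) xy'(3) a' b' by simp
  then show thesis using that[OF C(1)] C(2) vB by blast
qed

text \<open>A maximal clique with only good triangles can absorb a one-vertex ear by triangle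
  exchange, while a path ear would split a triangle unbalanced; so it is all of \<open>B\<close>.
  Running once around a triangle reverses directions, so every edge is a digon.\<close>

lemma good_triangles_complete:
  assumes "C \<subseteq> B" "card C = 3" "good B T C" "\<And>a b. a \<in> C \<Longrightarrow> b \<in> C \<Longrightarrow> a \<noteq> b \<Longrightarrow> E a b"
    and "u \<in> B" "v \<in> B" "u \<noteq> v"
  shows "R d u v"
proof -
  define F where "F = {K. K \<subseteq> B \<and> C \<subseteq> K \<and> (\<forall>a\<in>K. \<forall>b\<in>K. a \<noteq> b \<longrightarrow> E a b) \<and>
    (\<forall>a\<in>K. \<forall>b\<in>K. \<forall>c\<in>K. a \<noteq> b \<longrightarrow> a \<noteq> c \<longrightarrow> b \<noteq> c \<longrightarrow> good B T {a, b, c})}"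
  have finB: "finite B" using finite_S[OF sliding] .
  have "finite F" unfolding F_def using finB by (auto intro: finite_subset[of _ "Pow B"])
  moreover have "C \<in> F"
  proof -
    have "{a, b, c} = C" if "a \<in> C" "b \<in> C" "c \<in> C" "a \<noteq> b" "a \<noteq> c" "b \<noteq> c" for a b c
      using card_subset_eq[of C "{a, b, c}"] that finite_subset[OF assms(1) finB] assms(2) by auto
    then show ?thesis unfolding F_def using assms(1,3,4) by auto
  qed
  ultimately have "\<exists>K\<in>F. C \<subseteq> K \<and> (\<forall>K'\<in>F. K \<subseteq> K' \<longrightarrow> K = K')"
    by (rule finite_has_maximal2)
  then obtain K where KF: "K \<in> F" and max: "\<forall>K'\<in>F. K \<subseteq> K' \<longrightarrow> K = K'"
    by (elim bexE conjE)
  have KB: "K \<subseteq> B" and CK: "C \<subseteq> K" and clique: "\<And>a b. a \<in> K \<Longrightarrow> b \<in> K \<Longrightarrow> a \<noteq> b \<Longrightarrow> E a b"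
    and tri: "\<And>a b c. a \<in> K \<Longrightarrow> b \<in> K \<Longrightarrow> c \<in> K \<Longrightarrow> a \<noteq> b \<Longrightarrow> a \<noteq> c \<Longrightarrow> b \<noteq> c \<Longrightarrow> good B T {a, b, c}"
    using KF unfolding F_def by blast+
  have third: "\<exists>c\<in>K. c \<noteq> a \<and> c \<noteq> b" for a b
  proof (rule ccontr)
    assume "\<not> ?thesis"
    then have "C \<subseteq> {a, b}" using CK by blast
    then have "card C \<le> card {a, b}" by (rule card_mono[rotated]) simp
    also have "\<dots> \<le> 2" by (simp add: card_insert_if)
    finally show False using assms(2) by simp
  qed
  have bic3: "biconn E {a, b, c}" if "a \<in> K" "b \<in> K" "c \<in> K" for a b c
    by (rule biconn_clique) (use that clique in blast)
  have "K = B"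
  proof (rule ccontr)
    assume "K \<noteq> B"
    then have "K \<subset> B" using KB by blast
    moreover have "biconn E K" using clique by (rule biconn_clique)
    moreover have "2 \<le> card K" using card_mono[OF finite_subset[OF KB finB] CK] assms(2) by simp
    ultimately show False
    proof (cases rule: ear[OF symp_E finB bic, of K, consumes 3, case_names vertex path])
      case (path R a b p q)
      \<comment> \<open>The ear touches \<open>K\<close> only at \<open>a\<close> and
        \<open>b\<close>: \<open>c\<close> is left untouched and \<open>a\<close> has the single
        outside neighbour \<open>p\<close>.\<close>
      obtain c where c: "c \<in> K" "c \<noteq> a" "c \<noteq> b" using third by blast
      let ?C = "{a, b, c}"
      have sub: "?C \<subseteq> K" and disj: "K \<inter> R = {}" using path c by auto
      have bicU: "biconn E (?C \<union> R)" by (rule path(9)[OF sub]) (use bic3 path c in auto)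
      show False
        by (rule good_unbalanced_split_False[OF sliding tri[OF path(3,4) c(1)] _ _ bicU bic3[OF path(3,4) c(1)], of c a b c p])
          (use path(1-7) path(8)[OF subsetD[OF sub]] c KB disj clique in auto)
    next
      case (vertex w a b)
      \<comment> \<open>A clique vertex \<open>d\<close> not adjacent to \<open>w\<close> would be
        the untouched vertex in a split of \<open>{a, b, d}\<close>, unbalanced at
        \<open>a\<close>.\<close>
      have adj: "E d w" if d: "d \<in> K" for d
      proof (rule ccontr)
        assume no: "\<not> E d w"
        then have ne: "d \<noteq> a" "d \<noteq> b" using vertex by auto
        have wn: "w \<noteq> a" "w \<noteq> b" "w \<noteq> d" using vertex d by auto
        have bicI: "biconn E (insert w {a, b, d})"
          by (rule biconn_insert[OF symp_E bic3[OF vertex(2,3) d], of a b]) (use vertex wn in auto)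
        show False
          by (rule good_unbalanced_split_False[OF sliding tri[OF vertex(2,3) d] _ _ bicI bic3[OF vertex(2,3) d], of d a b d w])
            (use vertex d no ne wn KB clique in auto)
      qed
      have new: "good B T {a, b, w}" if ab: "a \<in> K" "b \<in> K" "a \<noteq> b" for a b
      proof -
        obtain c where c: "c \<in> K" "c \<noteq> a" "c \<noteq> b" using third by blast
        show ?thesis
          by (rule good_triangle_exchange[OF sliding tri[OF ab(1,2) c(1)]])
            (use ab c adj vertex(1) KB clique in auto)
      qed
      have perm: "{a, w, b} = {a, b, w}" "{w, a, b} = {a, b, w}" for a b by auto
      have "insert w K \<in> F" unfolding F_def
      proof (intro CollectI conjI ballI impI)
        show "insert w K \<subseteq> B" "C \<subseteq> insert w K" using vertex KB CK by auto
        show "E a b" if "a \<in> insert w K" "b \<in> insert w K" "a \<noteq> b" for a b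
          using that clique adj E_sym by auto
        show "good B T {a, b, c}" if "a \<in> insert w K" "b \<in> insert w K" "c \<in> insert w K"
          "a \<noteq> b" "a \<noteq> c" "b \<noteq> c" for a b c
          using that tri new perm by (elim insertE) (simp_all add: perm)
      qed
      then show False using max vertex(1) by blast
    qed
  qed
  then obtain w where w: "w \<in> K" "w \<noteq> u" "w \<noteq> v" and K: "u \<in> K" "v \<in> K"
    using third assms(5,6) by blast
  have g: "R d x y \<longleftrightarrow> R d x z"
    if K3: "x \<in> K" "y \<in> K" "z \<in> K" and dist: "x \<noteq> y" "x \<noteq> z" "y \<noteq> z" for d x y z
  proof (rule good_two_neighbours[OF sliding tri[OF K3 dist] _ bic3[OF K3]])
    show "{x, y, z} \<subseteq> B" using K3 KB by blast
    show "E x a \<longleftrightarrow> a = y \<or> a = z" if "a \<in> {x, y, z}" for a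
      using that dist clique[of x a] K3 by auto
  qed (use dist in auto)
  \<comment> \<open>Turning at a vertex keeps the direction, and reading an edge from its other end
    reverses it. Three edges give three reversals.\<close>
  have "R d u v \<longleftrightarrow> R (\<not> d) u v" for d
  proof -
    have "R d u v \<longleftrightarrow> R d u w" using g[of u v w] assms(7) w K by auto
    also have "\<dots> \<longleftrightarrow> R (\<not> d) w u" using R_not[of d w u] by simp
    also have "\<dots> \<longleftrightarrow> R (\<not> d) w v" using g[of w u v] assms(7) w K by auto
    also have "\<dots> \<longleftrightarrow> R d v w" using R_not[of d w v] by simp
    also have "\<dots> \<longleftrightarrow> R d v u" using g[of v w u] assms(7) w K by auto
    also have "\<dots> \<longleftrightarrow> R (\<not> d) u v" using R_not[of d u v] by simp
    finally show ?thesis .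
  qed
  moreover obtain e where "R e u v" using clique[OF K assms(7)] unfolding E_def by blast
  ultimately show ?thesis by (cases "d = e") auto
qed

text \<open>In the cycle case only local agreement is recorded: each vertex has the same directions
  towards both neighbours. Whether the cycle is bidirected or antidirected is decided by the
  presence of a digon, in \<open>low_block\<close>.\<close>

theorem polychromatic:
  assumes "3 \<le> card B" "(v, t) \<in> T" "2 \<le> card (col B T v)"
  shows "(\<forall>u\<in>B. \<forall>w\<in>B. u \<noteq> w \<longrightarrow> (\<forall>d. R d u w)) \<or>
    (\<exists>n c. cycle_enum E n c B \<and> (\<forall>u\<in>B. \<forall>a\<in>B. \<forall>b\<in>B. E u a \<longrightarrow> E u b \<longrightarrow> (\<forall>d. R d u a \<longleftrightarrow> R d u b)))"
proof -
  obtain n c C where C: "cycle_enum E n c C" "C \<subseteq> B" "good B T C"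
    using good_cycle_exists[OF assms] .
  have finB: "finite B" using finite_S[OF sliding] .
  have bicC: "biconn E C" using cycle_enum_biconn[OF symp_E C(1)] .
  have n: "card C = n" "3 \<le> n" using cycle_enum_card C(1) unfolding cycle_enum_def by auto
  consider "n = 3" | "C = B" | "4 \<le> n" "C \<subset> B"
  proof -
    have "n = 3 \<or> 4 \<le> n" using n(2) by linarith
    then show ?thesis using that C(2) by blast
  qed
  then show ?thesis
  proof cases
    case 1
    have "E a b" if ab: "a \<in> C" "b \<in> C" "a \<noteq> b" for a b
    proof -
      obtain p q where pq: "p \<in> C" "q \<in> C" "p \<noteq> q" "p \<noteq> a" "q \<noteq> a" "\<And>u. u \<in> C \<Longrightarrow> E a u \<longleftrightarrow> u = p \<or> u = q"
        using cycle_enum_neighbours[OF C(1) ab(1)] by metis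
      have "{a, p, q} = C"
        using card_subset_eq[of C "{a, p, q}"] pq ab finite_subset[OF C(2) finB] n 1 by auto
      then show ?thesis using ab pq by auto
    qed
    then show ?thesis using good_triangles_complete[OF C(2) _ C(3)] n 1 by blast
  next
    case 2
    have "R d u a \<longleftrightarrow> R d u b" if uab: "u \<in> B" "a \<in> B" "b \<in> B" "E u a" "E u b" for u a b d
    proof -
      obtain p q where pq: "p \<in> C" "q \<in> C" "p \<noteq> q" "p \<noteq> u" "q \<noteq> u" "\<And>z. z \<in> C \<Longrightarrow> E u z \<longleftrightarrow> z = p \<or> z = q"
        using cycle_enum_neighbours[OF C(1), of u] uab(1) 2 by metis
      have "R d u p \<longleftrightarrow> R d u q"
        by (rule good_two_neighbours[OF sliding C(3,2) bicC _ pq(1-3)]) (use uab 2 pq in auto)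
      then show ?thesis using pq(6)[of a] pq(6)[of b] uab 2 by auto
    qed
    then show ?thesis using C(1) 2 by blast
  next
    case 3
    have "2 \<le> card C" using n by simp
    then have False
    proof (cases rule: ear[OF symp_E finB bic 3(2) bicC, consumes 1, case_names vertex path])
      case (path R a b p q)
      have disj: "C \<inter> R = {}" using path(1) by auto
      have bicU: "biconn E (C \<union> R)" by (rule path(9)[OF subset_refl path(3,4) bicC])
      \<comment> \<open>The ear meets the cycle in two vertices only, so a third one is untouched,
        and the split is unbalanced at \<open>a\<close>.\<close>
      have "\<exists>z\<in>C. z \<noteq> a \<and> z \<noteq> b"
      proof (rule ccontr)
        assume "\<not> ?thesis"
        then have "C \<subseteq> {a, b}" by blast
        then have "card C \<le> card {a, b}" by (rule card_mono[rotated]) simp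
        also have "\<dots> \<le> 2" by (simp add: card_insert_if)
        finally show False using n by simp
      qed
      then obtain z where z: "z \<in> C" "z \<noteq> a" "z \<noteq> b" by blast
      obtain p' q' where pq: "p' \<in> C" "q' \<in> C" "p' \<noteq> q'" "\<And>u. u \<in> C \<Longrightarrow> E a u \<longleftrightarrow> u = p' \<or> u = q'"
        using cycle_enum_neighbours[OF C(1) path(3)] by metis
      show False
        by (rule good_unbalanced_split_False[OF sliding C(3) _ _ bicU bicC z(1) _ path(3) pq(1-4), of p])
          (use path(1-8) z C(2) disj in auto)
    next
      case (vertex w a b)
      have bicI: "biconn E (insert w C)"
        by (rule biconn_insert[OF symp_E bicC vertex(2-4)]) (use vertex in auto)
      \<comment> \<open>A single vertex may see many vertices of the cycle, but never all of
        them.\<close>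
      obtain z where z: "z \<in> C" "\<not> E z w"
        using good_cycle_dominated_False[OF sliding C(3,2,1) 3(1) vertex(1)] by blast
      obtain p' q' where pq: "p' \<in> C" "q' \<in> C" "p' \<noteq> q'" "\<And>u. u \<in> C \<Longrightarrow> E a u \<longleftrightarrow> u = p' \<or> u = q'"
        using cycle_enum_neighbours[OF C(1) vertex(2)] by metis
      show False
        by (rule good_unbalanced_split_False[OF sliding C(3) _ _ bicI bicC z(1) _ vertex(2) pq(1-4), of w])
          (use vertex z C(2) in auto)
    qed
    then show ?thesis ..
  qed
qed

end

end

section \<open>One active colour: a copy of the board among the colours\<close>

context token_system
begin

text \<open>Every token is active: bring the hole next to \<open>u\<close> without disturbing the
  token on \<open>u\<close>, then move it onto \<open>u\<close>; the colour laid down on the way is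
  a contact of that token. With one active colour per vertex this determines all tokens.\<close>

lemma monochromatic:
  assumes sliding: "sliding B T" and bic: "biconn E B" and "2 \<le> card B" "(v, t) \<in> T"
    and mono: "card (col B T v) \<le> 1"
  obtains x where "\<And>u. u \<in> B \<Longrightarrow> x u \<in> X u"
    "\<And>v t u. (v, t) \<in> T \<Longrightarrow> u \<in> B - {v} \<Longrightarrow> t u = x u"
    "\<And>u w b. u \<in> B \<Longrightarrow> w \<in> B \<Longrightarrow> R b u w \<longleftrightarrow> A b (x u) (x w)"
proof -
  have ne: "T \<noteq> {}" using assms(4) by auto
  have conn: "conn E B" using bic unfolding biconn_def by blast
  have nb: "\<exists>w\<in>B - {u}. E u w" if u: "u \<in> B" for u
  proof -
    have "B \<noteq> {u}" using assms(3) by auto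
    then obtain a w where "a \<in> {u}" "w \<in> B - {u}" "E a w" using conn_crossing[OF conn, of "{u}"] u by auto
    then show ?thesis by blast
  qed
  have vB: "v \<in> B" using hole_in[OF sliding assms(4)] .
  have "\<exists>x. col B T u = {x}" if u: "u \<in> B" for u
  proof -
    obtain w where w: "w \<in> B - {u}" "E u w" using nb[OF u] by blast
    obtain c where c: "R c u w" using w unfolding E_def by blast
    obtain t' where t': "(u, t') \<in> T" using exists_hole[OF sliding conn ne u] by blast
    obtain y where y: "y \<in> X u" "A c y (t' w)" using covered[OF sliding t', of w c] w c by blast
    have "y \<in> col B T u" using colI[of u t' T y w B c] t' y w by simp
    moreover have "card (col B T u) \<le> Suc 0" using card_col[OF sliding bic ne u vB] mono by simp
    ultimately show ?thesis using card_le_Suc0_iff_eq[OF finite_col] by blast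
  qed
  then obtain x where x: "\<And>u. u \<in> B \<Longrightarrow> col B T u = {x u}" by metis
  have xX: "x u \<in> X u" if "u \<in> B" for u using x[OF that] unfolding col_def by blast
  have token: "t u = x u" if t: "(v, t) \<in> T" and u: "u \<in> B - {v}" for v t u
  proof -
    obtain w where w: "w \<in> B - {u}" "E u w" using nb u by blast
    have "conn E (B - {u})" using bic u unfolding biconn_def by blast
    then obtain t' where t': "(w, t') \<in> T" "t' u = t u"
      using hole_moves[OF sliding, of "B - {u}" v w t] t u w hole_in[OF sliding t] by auto
    obtain c where c: "R c w u" using E_sym[OF w(2)] unfolding E_def by blast
    obtain y where y: "y \<in> X w" "A c y (t' u)" using covered[OF sliding t'(1), of u c] c u by blast
    have "(u, t'(w := y)) \<in> T" using move[OF sliding t'(1) y(1), of u c] y u w by auto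
    moreover have "t' u \<in> X u" using token_in[OF sliding t'(1), of u] u w by auto
    moreover have "A (\<not> c) (t' u) y" using y A_not by blast
    ultimately have "t' u \<in> col B T u" using colI[of u "t'(w := y)" T "t' u" w B "\<not> c"] w by simp
    then show ?thesis using x[of u] u t' by simp
  qed
  have "R b u w \<longleftrightarrow> A b (x u) (x w)" if u: "u \<in> B" and w: "w \<in> B" for u w b
  proof
    assume r: "R b u w"
    then have uw: "u \<noteq> w" using R_irrefl by auto
    obtain t' where t': "(u, t') \<in> T" using exists_hole[OF sliding conn ne u] by blast
    obtain y where y: "y \<in> X u" "A b y (t' w)" using covered[OF sliding t' w r] by blast
    have "y \<in> col B T u" using colI[of u t' T y w B b] t' y w uw by simp
    then show "A b (x u) (x w)" using y x[OF u] token[OF t', of w] w uw by simp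
  next
    assume "A b (x u) (x w)"
    then show "R b u w" using A_imp_R[OF xX[OF u] xX[OF w]] by blast
  qed
  then show thesis using that[of x] xX token by blast
qed

end

section \<open>Simple digraphs and their blocks\<close>

lemma simple_digraph_iff:
  "simple_digraph G \<longleftrightarrow> finite (verts G) \<and> arcs G \<subseteq> verts G \<times> verts G \<and> (\<forall>v. (v, v) \<notin> arcs G) \<and>
     tail G = fst \<and> head G = snd"
proof
  assume G: "simple_digraph G"
  then interpret digraph G unfolding simple_digraph_def by simp
  have th: "tail G = fst" "head G = snd" using G unfolding simple_digraph_def by auto
  have "arcs G \<subseteq> verts G \<times> verts G"
  proof
    fix e assume "e \<in> arcs G"
    then show "e \<in> verts G \<times> verts G" using tail_in_verts[of e] head_in_verts[of e] th by (cases e) auto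
  qed
  moreover have "\<forall>v. (v, v) \<notin> arcs G" using no_loops th by fastforce
  ultimately show "finite (verts G) \<and> arcs G \<subseteq> verts G \<times> verts G \<and> (\<forall>v. (v, v) \<notin> arcs G) \<and>
     tail G = fst \<and> head G = snd" using th by simp
next
  assume G: "finite (verts G) \<and> arcs G \<subseteq> verts G \<times> verts G \<and> (\<forall>v. (v, v) \<notin> arcs G) \<and>
     tail G = fst \<and> head G = snd"
  have "digraph G"
  proof
    show "finite (arcs G)" using G by (meson finite_SigmaI finite_subset)
    show "tail G e \<in> verts G" "head G e \<in> verts G" if "e \<in> arcs G" for e using G that by auto
    show "tail G e \<noteq> head G e" if "e \<in> arcs G" for e using G that by (cases e) auto
    show "e1 = e2" if "arc_to_ends G e1 = arc_to_ends G e2" for e1 e2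
      using G that unfolding arc_to_ends_def by (cases e1; cases e2) auto
  qed (use G in auto)
  then show "simple_digraph G" using G unfolding simple_digraph_def by simp
qed

lemma simple_digraph_wf: "simple_digraph G \<Longrightarrow> wf_digraph G"
  unfolding simple_digraph_iff by unfold_locales auto

lemma dgraph_eqI:
  fixes G H :: "('a, 'b) pre_digraph"
  assumes "verts G = verts H" "arcs G = arcs H" "tail G = tail H" "head G = head H"
  shows "G = H"
  using assms by (auto intro: pre_digraph.equality)

lemma induce_simple:
  assumes "simple_digraph G" "S \<subseteq> verts G"
  shows "simple_digraph (G \<restriction> S)"
  using assms unfolding simple_digraph_iff induce_subgraph_def by (auto intro: finite_subset)

lemma induced_subgraph_induce:
  assumes "simple_digraph G" "S \<subseteq> S'" "S' \<subseteq> verts G"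
  shows "induced_subgraph (G \<restriction> S) (G \<restriction> S')"
proof -
  have "wf_digraph (G \<restriction> S)" "wf_digraph (G \<restriction> S')"
    using assms by (meson induce_simple simple_digraph_wf subset_trans)+
  then show ?thesis using assms(2)
    unfolding induced_subgraph_def subgraph_def compatible_def induce_subgraph_def by auto
qed

lemma del_vert_induce: "delete_vertex (G \<restriction> S) v = G \<restriction> (S - {v})"
  unfolding pre_digraph.del_vert_def induce_subgraph_def by auto

lemma induce_verts: "simple_digraph G \<Longrightarrow> G \<restriction> verts G = G"
  unfolding simple_digraph_iff by (intro dgraph_eqI) (auto simp: induce_subgraph_def)

lemma digraph_isoI:
  fixes G :: "'a dgraph" and H :: "'b dgraph"
  assumes "wf_digraph G" "wf_digraph H" "tail G = fst" "head G = snd" "tail H = fst" "head H = snd"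
    and bij: "bij_betw f (verts G) (verts H)"
    and adj: "\<And>u v. u \<in> verts G \<Longrightarrow> v \<in> verts G \<Longrightarrow> (u, v) \<in> arcs G \<longleftrightarrow> (f u, f v) \<in> arcs H"
  shows "digraph_iso G H"
proof -
  have arcsG: "arcs G \<subseteq> verts G \<times> verts G" and arcsH: "arcs H \<subseteq> verts H \<times> verts H"
    using wf_digraph.tail_in_verts[OF assms(1)] wf_digraph.head_in_verts[OF assms(1)]
      wf_digraph.tail_in_verts[OF assms(2)] wf_digraph.head_in_verts[OF assms(2)] assms(3-6)
    by (auto simp: mem_Times_iff)
  let ?h = "\<lparr>iso_verts = f, iso_arcs = map_prod f f, iso_head = snd, iso_tail = fst\<rparr>"
  have inj: "inj_on f (verts G)" and img: "f ` verts G = verts H" using bij unfolding bij_betw_def by auto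
  have "inj_on (map_prod f f) (arcs G)" using map_prod_inj_on[OF inj inj] arcsG inj_on_subset by blast
  then have 1: "pre_digraph.digraph_isomorphism G ?h"
    unfolding pre_digraph.digraph_isomorphism_def using assms inj by auto
  have "arcs H = map_prod f f ` arcs G"
  proof
    show "map_prod f f ` arcs G \<subseteq> arcs H" using adj arcsG by auto
    show "arcs H \<subseteq> map_prod f f ` arcs G"
    proof
      fix e assume e: "e \<in> arcs H"
      then have "fst e \<in> f ` verts G" "snd e \<in> f ` verts G" using arcsH img by auto
      then obtain u v where "u \<in> verts G" "v \<in> verts G" "e = (f u, f v)" by (metis imageE prod.collapse)
      then show "e \<in> map_prod f f ` arcs G" using adj[of u v] e by force
    qed
  qed
  then have "H = app_iso ?h G" unfolding app_iso_def using img assms by (intro dgraph_eqI) auto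
  then show ?thesis using 1 unfolding digraph_iso_def by blast
qed

definition adj :: "'a dgraph \<Rightarrow> 'a \<Rightarrow> 'a \<Rightarrow> bool" where
  "adj G u v \<longleftrightarrow> (u, v) \<in> arcs G \<or> (v, u) \<in> arcs G"

lemma symp_adj: "symp (adj G)"
  unfolding adj_def symp_def by blast

lemma mk_symmetric_simps:
  assumes "simple_digraph G"
  shows "verts (with_proj (mk_symmetric G)) = verts G" "arcs (with_proj (mk_symmetric G)) = {(u, v). adj G u v}"
    "tail (with_proj (mk_symmetric G)) = fst" "head (with_proj (mk_symmetric G)) = snd"
    "wf_digraph (with_proj (mk_symmetric G))"
proof -
  show v: "verts (with_proj (mk_symmetric G)) = verts G"
    and t: "tail (with_proj (mk_symmetric G)) = fst" "head (with_proj (mk_symmetric G)) = snd"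
    unfolding mk_symmetric_def with_proj_def by auto
  show a: "arcs (with_proj (mk_symmetric G)) = {(u, v). adj G u v}"
    using assms unfolding mk_symmetric_def with_proj_def adj_def simple_digraph_iff by force
  show "wf_digraph (with_proj (mk_symmetric G))"
    unfolding wf_digraph_def v a t using assms unfolding simple_digraph_iff adj_def by auto
qed

text \<open>Translates reachability in the symmetric closure into the cut condition. Nonemptiness is
  listed separately because \<open>conn\<close> holds for the empty set.\<close>

lemma connected_iff_conn:
  assumes G: "simple_digraph G"
  shows "connected_digraph G \<longleftrightarrow> verts G \<noteq> {} \<and> conn (adj G) (verts G)"
proof -
  let ?S = "with_proj (mk_symmetric G)"
  interpret wf_digraph ?S by (rule mk_symmetric_simps(5)[OF G])
  have dom: "u \<rightarrow>\<^bsub>?S\<^esub> v \<longleftrightarrow> adj G u v" for u v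
    unfolding arcs_ends_def arc_to_ends_def mk_symmetric_simps[OF G] by auto
  show ?thesis
  proof
    assume "connected_digraph G"
    then have ne: "verts G \<noteq> {}" and r: "\<And>u v. u \<in> verts G \<Longrightarrow> v \<in> verts G \<Longrightarrow> u \<rightarrow>\<^sup>*\<^bsub>?S\<^esub> v"
      unfolding connected_def strongly_connected_def mk_symmetric_simps[OF G] by auto
    have "conn (adj G) (verts G)"
      unfolding conn_def
    proof (intro allI impI, rule ccontr)
      fix K assume K: "K \<subseteq> verts G" "K \<noteq> {}" "K \<noteq> verts G"
        and no: "\<not> (\<exists>a\<in>K. \<exists>b\<in>verts G - K. adj G a b)"
      obtain u v where uv: "u \<in> K" "v \<in> verts G" "v \<notin> K" using K by blast
      have "u \<rightarrow>\<^sup>*\<^bsub>?S\<^esub> v" using r uv K by blast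
      then have "v \<in> K"
      proof (induction rule: reachable_induct)
        case base
        then show ?case using uv by simp
      next
        case (step x y)
        have "y \<in> verts G" using step(2) unfolding dom using G unfolding adj_def simple_digraph_iff by auto
        then show ?case using no step unfolding dom by blast
      qed
      then show False using uv by simp
    qed
    then show "verts G \<noteq> {} \<and> conn (adj G) (verts G)" using ne by simp
  next
    assume c: "verts G \<noteq> {} \<and> conn (adj G) (verts G)"
    have "u \<rightarrow>\<^sup>*\<^bsub>?S\<^esub> v" if "u \<in> verts G" "v \<in> verts G" for u v
    proof (rule conn_induct[OF conjunct2[OF c] that])
      show "u \<rightarrow>\<^sup>*\<^bsub>?S\<^esub> u" using that mk_symmetric_simps(1)[OF G] by simp
      show "u \<rightarrow>\<^sup>*\<^bsub>?S\<^esub> b" if "u \<rightarrow>\<^sup>*\<^bsub>?S\<^esub> a" "adj G a b" for a b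
        using that dom reachable_adj_trans by blast
    qed
    then show "connected_digraph G"
      using c unfolding connected_def strongly_connected_def mk_symmetric_simps[OF G] by auto
  qed
qed

lemma subgraph_simple:
  assumes "simple_digraph G" "subgraph C G"
  shows "simple_digraph C"
proof -
  have "arcs C \<subseteq> verts C \<times> verts C" "tail C = fst" "head C = snd"
    using assms wf_digraph.tail_in_verts[of C] wf_digraph.head_in_verts[of C]
    unfolding simple_digraph_iff subgraph_def compatible_def by (auto simp: mem_Times_iff)
  then show ?thesis using assms unfolding simple_digraph_iff subgraph_def by (auto intro: finite_subset)
qed

lemma subgraph_self: "simple_digraph G \<Longrightarrow> subgraph G G"
  unfolding subgraph_def compatible_def using simple_digraph_wf by auto

lemma finite_subgraphs:
  assumes "simple_digraph G"
  shows "finite {C. subgraph C G}"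
proof -
  have "finite (verts G)" "finite (arcs G)"
    using assms unfolding simple_digraph_iff by (auto intro: finite_subset)
  then have "finite (Pow (verts G) \<times> Pow (arcs G))" by simp
  moreover have "(\<lambda>C. (verts C, arcs C)) ` {C. subgraph C G} \<subseteq> Pow (verts G) \<times> Pow (arcs G)"
    unfolding subgraph_def by auto
  moreover have "inj_on (\<lambda>C. (verts C, arcs C)) {C. subgraph C G}"
    unfolding subgraph_def compatible_def by (auto intro!: inj_onI dgraph_eqI)
  ultimately show ?thesis by (meson finite_imageD finite_subset)
qed

text \<open>A connected subgraph on more vertices would have an edge leaving \<open>K\<close>, and
  one on the same vertices has no further arcs.\<close>

lemma closed_conn_component:
  assumes G: "simple_digraph G" and K: "K \<subseteq> verts G" "K \<noteq> {}" "conn (adj G) K"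
    and closed: "\<And>a b. a \<in> K \<Longrightarrow> b \<in> verts G - K \<Longrightarrow> \<not> adj G a b"
  shows "G \<restriction> K \<in> components G"
proof -
  have simple: "simple_digraph (G \<restriction> K)" using induce_simple G K by blast
  have "subgraph (G \<restriction> K) G"
    using induced_subgraph_induce[OF G K(1) subset_refl] induce_verts[OF G]
    unfolding induced_subgraph_def by simp
  moreover have "conn (adj (G \<restriction> K)) K"
    by (rule conn_mono[OF K(3)]) (use G in \<open>auto simp: adj_def induce_subgraph_def simple_digraph_iff\<close>)
  then have "connected_digraph (G \<restriction> K)" using connected_iff_conn[OF simple] K by simp
  moreover have "H = G \<restriction> K" if H: "subgraph (G \<restriction> K) H" "subgraph H G" "connected_digraph H" for H
  proof -
    have sH: "simple_digraph H" using subgraph_simple G H by blast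
    have KH: "K \<subseteq> verts H" using H unfolding subgraph_def by simp
    have "verts H = K"
    proof (rule ccontr)
      assume "verts H \<noteq> K"
      then obtain a b where "a \<in> K" "b \<in> verts H - K" "adj H a b"
        using conn_crossing[of "adj H" "verts H" K] H(3) connected_iff_conn[OF sH] KH K(2) by blast
      then show False using closed[of a b] H(2) unfolding subgraph_def adj_def by blast
    qed
    then show ?thesis
      using H sH simple G unfolding subgraph_def simple_digraph_iff
      by (intro dgraph_eqI) (auto simp: induce_subgraph_def)
  qed
  ultimately show ?thesis unfolding components_def pre_digraph.max_subgraph_def by blast
qed

text \<open>If the cut condition fails, there is a component on each side of the cut; if it holds,
  every component is the whole digraph. For the empty digraph both sides are false, which is the
  case of deleting the only vertex.\<close>

lemma two_components_iff:
  assumes G: "simple_digraph G"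
  shows "2 \<le> card (components G) \<longleftrightarrow> \<not> conn (adj G) (verts G)"
proof
  assume two: "2 \<le> card (components G)"
  show "\<not> conn (adj G) (verts G)"
  proof
    assume c: "conn (adj G) (verts G)"
    have "components G \<subseteq> {G}"
    proof
      fix C assume "C \<in> components G"
      then have C: "subgraph C G" "connected_digraph C"
        and max: "\<And>H. H \<noteq> C \<Longrightarrow> subgraph C H \<Longrightarrow> \<not> (subgraph H G \<and> connected_digraph H)"
        unfolding components_def pre_digraph.max_subgraph_def by auto
      have "verts C \<noteq> {}" using C connected_iff_conn[OF subgraph_simple[OF G C(1)]] by blast
      then have "connected_digraph G" using connected_iff_conn[OF G] c C unfolding subgraph_def by blast
      then show "C \<in> {G}" using max[of G] C(1) subgraph_self[OF G] by blast
    qed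
    then have "card (components G) \<le> card {G}" by (rule card_mono[rotated]) simp
    then show False using two by simp
  qed
next
  assume "\<not> conn (adj G) (verts G)"
  then obtain K where K: "K \<subseteq> verts G" "K \<noteq> {}" "K \<noteq> verts G"
    and no: "\<And>a b. a \<in> K \<Longrightarrow> b \<in> verts G - K \<Longrightarrow> \<not> adj G a b" unfolding conn_def by blast
  have fin: "finite (verts G)" using G unfolding simple_digraph_iff by simp
  obtain K1 where K1: "K1 \<subseteq> K" "K1 \<noteq> {}" "conn (adj G) K1" "\<And>a b. a \<in> K1 \<Longrightarrow> b \<in> K - K1 \<Longrightarrow> \<not> adj G a b"
    using conn_closed_minimal[OF symp_adj finite_subset[OF K(1) fin] K(2)] by blast
  have ne: "verts G - K \<noteq> {}" and finK: "finite (verts G - K)" using K fin by auto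
  obtain K2 where K2: "K2 \<subseteq> verts G - K" "K2 \<noteq> {}" "conn (adj G) K2"
    "\<And>a b. a \<in> K2 \<Longrightarrow> b \<in> verts G - K - K2 \<Longrightarrow> \<not> adj G a b"
    using conn_closed_minimal[OF symp_adj finK ne] by blast
  have 1: "G \<restriction> K1 \<in> components G"
  proof (rule closed_conn_component[OF G _ K1(2,3)])
    show "\<not> adj G a b" if "a \<in> K1" "b \<in> verts G - K1" for a b
      using that K1(4)[of a b] no[of a b] K1(1) by blast
  qed (use K1 K in blast)
  have 2: "G \<restriction> K2 \<in> components G"
  proof (rule closed_conn_component[OF G _ K2(2,3)])
    show "\<not> adj G a b" if "a \<in> K2" "b \<in> verts G - K2" for a b
      using that K2(4)[of a b] no[of b a] K2(1) sympD[OF symp_adj, of G a b] by blast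
  qed (use K2 in blast)
  have "K1 \<noteq> K2" using K1 K2 by blast
  then have "G \<restriction> K1 \<noteq> G \<restriction> K2" by (metis induce_subgraph_verts)
  then have "card {G \<restriction> K1, G \<restriction> K2} = 2" by simp
  moreover have "finite (components G)"
    using finite_subgraphs[OF G] by (rule finite_subset[rotated])
      (auto simp: components_def pre_digraph.max_subgraph_def)
  ultimately show "2 \<le> card (components G)"
    using card_mono[of "components G" "{G \<restriction> K1, G \<restriction> K2}"] 1 2 by simp
qed

lemma nonseparable_iff_biconn:
  assumes G: "simple_digraph G"
  shows "connected_digraph G \<and> (\<nexists>v. separating_vertex G v) \<longleftrightarrow> verts G \<noteq> {} \<and> biconn (adj G) (verts G)"
proof -
  have "2 \<le> card (components (delete_vertex G v)) \<longleftrightarrow> \<not> conn (adj G) (verts G - {v})" for v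
  proof -
    have eq: "delete_vertex G v = G \<restriction> (verts G - {v})"
      using del_vert_induce[of G "verts G" v] induce_verts[OF G] by simp
    have simple: "simple_digraph (delete_vertex G v)" unfolding eq using induce_simple[OF G] by blast
    have "conn (adj (delete_vertex G v)) (verts G - {v}) \<longleftrightarrow> conn (adj G) (verts G - {v})"
      using conn_mono[of "adj (delete_vertex G v)" "verts G - {v}" "adj G"]
        conn_mono[of "adj G" "verts G - {v}" "adj (delete_vertex G v)"] G
      unfolding eq adj_def induce_subgraph_def simple_digraph_iff by auto
    then show ?thesis using two_components_iff[OF simple] eq by simp
  qed
  then show ?thesis unfolding separating_vertex_def connected_iff_conn[OF G] biconn_def by blast
qed

text \<open>The digraph induced on the vertices of \<open>B\<close> has all arcs of
  \<open>B\<close>, so it is again connected without separating vertex, and maximality makes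
  \<open>B\<close> induced.\<close>

lemma block_biconn:
  assumes G: "simple_digraph G" and block: "block G B"
  shows "verts B \<subseteq> verts G" "verts B \<noteq> {}" "biconn (adj G) (verts B)" "B = G \<restriction> verts B"
proof -
  have sub: "subgraph B G" and con: "connected_digraph B \<and> (\<nexists>v. separating_vertex B v)"
    and max: "\<And>H. H \<noteq> B \<Longrightarrow> subgraph B H \<Longrightarrow>
      \<not> (subgraph H G \<and> connected_digraph H \<and> (\<nexists>v. separating_vertex H v))"
    using block unfolding block_def pre_digraph.max_subgraph_def by auto
  have simple: "simple_digraph B" using subgraph_simple[OF G sub] .
  show vs: "verts B \<subseteq> verts G" using sub unfolding subgraph_def by simp
  have bic: "verts B \<noteq> {}" "biconn (adj B) (verts B)" using con nonseparable_iff_biconn[OF simple] by auto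
  then show "verts B \<noteq> {}" by simp
  show bicG: "biconn (adj G) (verts B)"
    by (rule biconn_mono[OF bic(2)]) (use sub in \<open>auto simp: adj_def subgraph_def\<close>)
  let ?B = "G \<restriction> verts B"
  have simple': "simple_digraph ?B" using induce_simple[OF G vs] .
  have "biconn (adj ?B) (verts B)"
    by (rule biconn_mono[OF bicG]) (use G in \<open>auto simp: adj_def induce_subgraph_def simple_digraph_iff\<close>)
  then have "connected_digraph ?B \<and> (\<nexists>v. separating_vertex ?B v)"
    using nonseparable_iff_biconn[OF simple'] bic(1) by simp
  moreover have "subgraph ?B G"
    using induced_subgraph_induce[OF G vs subset_refl] induce_verts[OF G]
    unfolding induced_subgraph_def by simp
  moreover have "arcs B \<subseteq> arcs ?B"
    using sub simple G unfolding subgraph_def simple_digraph_iff by (auto simp: induce_subgraph_def)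
  then have "subgraph B ?B"
    using simple_digraph_wf[OF simple] simple_digraph_wf[OF simple'] sub
    unfolding subgraph_def compatible_def by (simp add: induce_subgraph_def)
  ultimately show "B = ?B" using max[of ?B] by metis
qed

section \<open>Low vertices of critical covers\<close>

text \<open>The form in which digraphs enter \<open>token_system\<close>: \<open>True\<close> reads
  arcs forwards, \<open>False\<close> backwards.\<close>

definition dir_arc :: "'a dgraph \<Rightarrow> bool \<Rightarrow> 'a \<Rightarrow> 'a \<Rightarrow> bool" where
  "dir_arc G b u v \<longleftrightarrow> (if b then (u, v) else (v, u)) \<in> arcs G"

definition dir_degree :: "'a dgraph \<Rightarrow> bool \<Rightarrow> 'a \<Rightarrow> nat" where
  "dir_degree G b v = card {u \<in> verts G. dir_arc G b v u}"

definition property_degree :: "'a::infinite dgraph set \<Rightarrow> bool \<Rightarrow> nat" where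
  "property_degree P b = (if b then d_plus P else d_minus P)"

lemma dir_degree_simps:
  assumes "simple_digraph G"
  shows "dir_degree G True v = out_degree G v" "dir_degree G False v = in_degree G v"
proof -
  have "{e \<in> arcs G. tail G e = v} = Pair v ` {u \<in> verts G. dir_arc G True v u}"
    "{e \<in> arcs G. head G e = v} = (\<lambda>u. (u, v)) ` {u \<in> verts G. dir_arc G False v u}"
    using assms unfolding simple_digraph_iff dir_arc_def by auto
  then show "dir_degree G True v = out_degree G v" "dir_degree G False v = in_degree G v"
    unfolding dir_degree_def out_degree_def in_degree_def out_arcs_def in_arcs_def
    by (simp_all add: card_image inj_on_def)
qed

lemma dir_arc_verts:
  "simple_digraph G \<Longrightarrow> dir_arc G b u v \<Longrightarrow> u \<in> verts G \<and> v \<in> verts G \<and> u \<noteq> v"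
  unfolding simple_digraph_iff dir_arc_def by (auto split: if_splits)

lemma dir_arc_induce:
  "simple_digraph G \<Longrightarrow> dir_arc (G \<restriction> S) b u v \<longleftrightarrow> dir_arc G b u v \<and> u \<in> S \<and> v \<in> S"
  unfolding simple_digraph_iff dir_arc_def induce_subgraph_def by auto

lemma dir_arc_not: "dir_arc G (\<not> b) u v \<longleftrightarrow> dir_arc G b v u"
  unfolding dir_arc_def by auto

text \<open>A minimal vertex set inducing a digraph outside \<open>P\<close> does it.\<close>

lemma exists_CR_induced:
  assumes G: "simple_digraph G" "G \<notin> P"
  obtains S where "S \<subseteq> verts G" "G \<restriction> S \<in> CR P"
proof -
  let ?F = "{S. S \<subseteq> verts G \<and> G \<restriction> S \<notin> P}"
  have "finite ?F" using G unfolding simple_digraph_iff by (auto intro: finite_subset[of _ "Pow (verts G)"])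
  moreover have "verts G \<in> ?F" using G(2) induce_verts[OF G(1)] by simp
  ultimately have "\<exists>S\<in>?F. S \<subseteq> verts G \<and> (\<forall>S'\<in>?F. S' \<subseteq> S \<longrightarrow> S = S')" by (rule finite_has_minimal2)
  then obtain S where S: "S \<subseteq> verts G" "G \<restriction> S \<notin> P" and min: "\<forall>S'\<in>?F. S' \<subseteq> S \<longrightarrow> S = S'"
    by blast
  have "delete_vertex (G \<restriction> S) v \<in> P" if "v \<in> S" for v
  proof (rule ccontr)
    assume "delete_vertex (G \<restriction> S) v \<notin> P"
    then have "S - {v} \<in> ?F" using S unfolding del_vert_induce by auto
    then show False using min that by blast
  qed
  then have "G \<restriction> S \<in> CR P" unfolding CR_def using S induce_simple[OF G(1)] by auto
  then show thesis using that S by blast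
qed

lemma property_degree_le:
  assumes K: "K \<in> CR P" and v: "v \<in> verts K"
  shows "property_degree P b \<le> dir_degree K b v"
proof -
  have simple: "simple_digraph K" using K unfolding CR_def by simp
  then have fin: "finite (verts K)" unfolding simple_digraph_iff by simp
  have "d_plus P \<le> min_out_degree K" "d_minus P \<le> min_in_degree K"
    unfolding d_plus_def d_minus_def using K by (auto intro: cINF_lower)
  moreover have "min_out_degree K \<le> out_degree K v" "min_in_degree K \<le> in_degree K v"
    unfolding min_out_degree_def min_in_degree_def using fin v by auto
  ultimately show ?thesis
    unfolding property_degree_def using dir_degree_simps[OF simple, of v] by (cases b) auto
qed

locale critical_cover_system =
  fixes P :: "'a::infinite dgraph set" and D H :: "'a dgraph" and X :: "'a \<Rightarrow> 'a set"
  assumes reliable: "reliable P" and simpleD: "simple_digraph D" and critical: "critical_cover P D X H"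
begin

text \<open>\<open>X\<close> is arbitrary outside \<open>verts D\<close>; empty lists there make the
  laws of \<open>token_system\<close> hold for every element of the type.\<close>

definition colours where "colours v = (if v \<in> verts D then X v else {})"

lemma simpleH: "simple_digraph H"
  and list_disjoint: "u \<in> verts D \<Longrightarrow> v \<in> verts D \<Longrightarrow> u \<noteq> v \<Longrightarrow> X u \<inter> X v = {}"
  and lists_cover: "(\<Union>v\<in>verts D. X v) = verts H"
  and list_independent: "v \<in> verts D \<Longrightarrow> arcs_between H (X v) (X v) = {}"
  and lists_matched: "u \<in> verts D \<Longrightarrow> v \<in> verts D \<Longrightarrow> u \<noteq> v \<Longrightarrow>
    (if (u, v) \<in> arcs D then matching (arcs_between H (X u) (X v)) else arcs_between H (X u) (X v) = {})"
  using critical unfolding critical_cover_def cover_def by blast+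

lemma finD: "finite (verts D)" and finH: "finite (verts H)"
  using simpleD simpleH unfolding simple_digraph_iff by auto

lemma list_verts: "v \<in> verts D \<Longrightarrow> X v \<subseteq> verts H"
  using lists_cover by blast

lemma arcs_betweenI: "x \<in> S \<Longrightarrow> y \<in> T \<Longrightarrow> (x, y) \<in> arcs H \<Longrightarrow> (x, y) \<in> arcs_between H S T"
  unfolding arcs_between_def using simpleH unfolding simple_digraph_iff by auto

lemma arc_lists:
  assumes "u \<in> verts D" "v \<in> verts D" "x \<in> X u" "y \<in> X v" "(x, y) \<in> arcs H"
  shows "(u, v) \<in> arcs D" "x' \<in> X u \<Longrightarrow> (x', y) \<in> arcs H \<Longrightarrow> x' = x" "y' \<in> X v \<Longrightarrow> (x, y') \<in> arcs H \<Longrightarrow> y' = y"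
proof -
  have in_between: "(x, y) \<in> arcs_between H (X u) (X v)" using arcs_betweenI assms by blast
  then have ne: "u \<noteq> v" using list_independent assms by blast
  show uv: "(u, v) \<in> arcs D"
    using lists_matched[OF assms(1,2) ne] in_between by (auto split: if_splits)
  then have m: "matching (arcs_between H (X u) (X v))" using lists_matched[OF assms(1,2) ne] by simp
  show "x' = x" if "x' \<in> X u" "(x', y) \<in> arcs H"
  proof -
    have "(x', y) \<in> arcs_between H (X u) (X v)" using arcs_betweenI that assms by blast
    then show ?thesis using m in_between unfolding matching_def by fastforce
  qed
  show "y' = y" if "y' \<in> X v" "(x, y') \<in> arcs H"
  proof -
    have "(x, y') \<in> arcs_between H (X u) (X v)" using arcs_betweenI that assms by blast
    then show ?thesis using m in_between unfolding matching_def by fastforce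
  qed
qed

sublocale token_system "dir_arc D" "dir_arc H" colours
proof
  show "dir_arc D (\<not> b) u v \<longleftrightarrow> dir_arc D b v u" "dir_arc H (\<not> b) u v \<longleftrightarrow> dir_arc H b v u" for b u v
    by (rule dir_arc_not)+
  show "\<not> dir_arc D b v v" for b v using dir_arc_verts[OF simpleD, of b v v] by auto
  show "finite (colours v)" for v using finite_subset[OF list_verts finH] unfolding colours_def by simp
  fix x u y v b
  assume "x \<in> colours u" "y \<in> colours v"
  then have uv: "u \<in> verts D" "v \<in> verts D" "x \<in> X u" "y \<in> X v" unfolding colours_def by (auto split: if_splits)
  assume xy: "dir_arc H b x y"
  show "dir_arc D b u v"
    using arc_lists(1)[OF uv] arc_lists(1)[OF uv(2,1,4,3)] xy unfolding dir_arc_def by (auto split: if_splits)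
  fix y' assume "y' \<in> colours v" "dir_arc H b x y'"
  then show "y = y'"
    using arc_lists(3)[OF uv, of y'] arc_lists(2)[OF uv(2,1,4,3), of y'] xy uv
    unfolding dir_arc_def colours_def by (auto split: if_splits)
qed

lemma E_eq_adj: "E = adj D"
proof (intro ext)
  show "E u v \<longleftrightarrow> adj D u v" for u v
    unfolding E_def ex_bool_eq by (simp add: adj_def dir_arc_def)
qed

definition tokens :: "'a \<Rightarrow> ('a \<Rightarrow> 'a) \<Rightarrow> 'a set" where
  "tokens v t = t ` (verts D - {v})"

text \<open>Partial transversals with domain \<open>verts D - {v}\<close>, written as choice
  functions.\<close>

definition configs :: "('a \<times> ('a \<Rightarrow> 'a)) set" where
  "configs = {(v, t). v \<in> verts D \<and> (\<forall>u\<in>verts D - {v}. t u \<in> X u) \<and> H \<restriction> tokens v t \<in> P}"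

lemma hereditary_induce:
  assumes "H \<restriction> S \<in> P" "S' \<subseteq> S" "S \<subseteq> verts H"
  shows "H \<restriction> S' \<in> P"
proof -
  have "hereditary P" using reliable unfolding reliable_def by simp
  then show ?thesis using induced_subgraph_induce[OF simpleH assms(2,3)] assms(1) unfolding hereditary_def by blast
qed

lemma configs_nonempty:
  assumes v: "v \<in> verts D"
  shows "\<exists>t. (v, t) \<in> configs"
proof -
  obtain T where T: "partial_transversal D X H T" "transversal_dom D X T = verts D - {v}" "H \<restriction> T \<in> P"
    using critical v unfolding critical_cover_def property_transversal_avoiding_def by blast
  have "\<exists>x. T \<inter> X u = {x}" if u: "u \<in> verts D - {v}" for u
  proof -
    have "u \<in> transversal_dom D X T" using T(2) u by simp
    then have "T \<inter> X u \<noteq> {}" unfolding transversal_dom_def by auto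
    moreover have "card (T \<inter> X u) \<le> Suc 0" using T(1) u unfolding partial_transversal_def by auto
    moreover have "finite (T \<inter> X u)" using finite_subset[OF list_verts finH, of u] u by auto
    ultimately show ?thesis using card_le_Suc0_iff_eq by blast
  qed
  then obtain t where t: "\<And>u. u \<in> verts D - {v} \<Longrightarrow> T \<inter> X u = {t u}" by metis
  have "tokens v t = T"
  proof
    show "tokens v t \<subseteq> T" unfolding tokens_def using t by blast
    show "T \<subseteq> tokens v t"
    proof
      fix x assume x: "x \<in> T"
      then have "x \<in> verts H" using T(1) unfolding partial_transversal_def by blast
      then obtain u where u: "u \<in> verts D" "x \<in> X u" using lists_cover by blast
      then have "u \<in> transversal_dom D X T" using x unfolding transversal_dom_def by blast
      then have "u \<in> verts D - {v}" using T(2) by simp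
      then show "x \<in> tokens v t" using t[of u] x u unfolding tokens_def by blast
    qed
  qed
  then have "(v, t) \<in> configs" unfolding configs_def using v t T(3) by blast
  then show ?thesis by blast
qed

lemma no_transversal:
  assumes "\<And>u. u \<in> verts D \<Longrightarrow> t u \<in> X u"
  shows "H \<restriction> (t ` verts D) \<notin> P"
proof
  assume inP: "H \<restriction> (t ` verts D) \<in> P"
  have "t ` verts D \<inter> X u = {t u}" if "u \<in> verts D" for u
    using assms that list_disjoint by blast
  moreover have "t ` verts D \<subseteq> verts H" using assms list_verts by blast
  ultimately have "transversal D X H (t ` verts D)" unfolding transversal_def by simp
  then show False using critical inP unfolding critical_cover_def property_transversal_def by blast
qed

text \<open>A critical subdigraph inside \<open>S\<close> must contain \<open>x\<close>, since the
  tokens alone induce a member of \<open>P\<close>; its minimum degree bounds the contacts of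
  \<open>x\<close>. The general \<open>S\<close> serves \<open>low_move\<close>, where one token has
  been dropped.\<close>

lemma hole_degree:
  assumes vt: "(v, t) \<in> configs" and x: "x \<in> X v"
    and bad: "H \<restriction> S \<notin> P" "S \<subseteq> insert x (tokens v t)"
  shows "property_degree P b \<le> card {u \<in> verts D - {v}. t u \<in> S \<and> dir_arc H b x (t u)}"
proof -
  have v: "v \<in> verts D" and tX: "\<And>u. u \<in> verts D - {v} \<Longrightarrow> t u \<in> X u" and tP: "H \<restriction> tokens v t \<in> P"
    using vt unfolding configs_def by auto
  have tH: "tokens v t \<subseteq> verts H" unfolding tokens_def using tX list_verts by blast
  have SH: "S \<subseteq> verts H" using bad(2) tH x list_verts[OF v] by blast
  obtain K0 where K0: "K0 \<subseteq> verts (H \<restriction> S)" "(H \<restriction> S) \<restriction> K0 \<in> CR P"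
    using exists_CR_induced[OF induce_simple[OF simpleH SH] bad(1)] by blast
  have KS: "K0 \<subseteq> S" using K0(1) by simp
  have "(H \<restriction> S) \<restriction> K0 = H \<restriction> K0"
    using KS by (intro dgraph_eqI) (auto simp: induce_subgraph_def)
  then have KCR: "H \<restriction> K0 \<in> CR P" using K0(2) by simp
  then have "H \<restriction> K0 \<notin> P" unfolding CR_def by simp
  then have xK: "x \<in> K0" using hereditary_induce[OF tP _ tH, of K0] KS bad(2) by blast
  have "property_degree P b \<le> dir_degree (H \<restriction> K0) b x"
    using property_degree_le[OF KCR] xK by simp
  also have "dir_degree (H \<restriction> K0) b x = card {y \<in> K0. dir_arc H b x y}"
    unfolding dir_degree_def using dir_arc_induce[OF simpleH, of K0] xK
    by (intro arg_cong[where f = card]) auto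
  also have "\<dots> \<le> card (t ` {u \<in> verts D - {v}. t u \<in> S \<and> dir_arc H b x (t u)})"
  proof (rule card_mono)
    show "{y \<in> K0. dir_arc H b x y} \<subseteq> t ` {u \<in> verts D - {v}. t u \<in> S \<and> dir_arc H b x (t u)}"
    proof
      fix y assume "y \<in> {y \<in> K0. dir_arc H b x y}"
      then have y: "y \<in> S" "dir_arc H b x y" using KS by auto
      then have "y \<noteq> x" using dir_arc_verts[OF simpleH] by blast
      then obtain u where "u \<in> verts D - {v}" "y = t u" using y bad(2) unfolding tokens_def by blast
      then show "y \<in> t ` {u \<in> verts D - {v}. t u \<in> S \<and> dir_arc H b x (t u)}" using y by blast
    qed
  qed (use finD in simp)
  also have "\<dots> \<le> card {u \<in> verts D - {v}. t u \<in> S \<and> dir_arc H b x (t u)}"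
    by (rule card_image_le) (use finD in simp)
  finally show ?thesis .
qed

lemma filled_hole:
  assumes vt: "(v, t) \<in> configs" and x: "x \<in> X v"
  shows "H \<restriction> insert x (tokens v t) \<notin> P"
proof -
  have v: "v \<in> verts D" using vt unfolding configs_def by auto
  have "insert x (tokens v t) = (t(v := x)) ` verts D"
    unfolding tokens_def using v by (auto simp: image_iff)
  then show ?thesis using no_transversal[of "t(v := x)"] vt x unfolding configs_def by auto
qed

text \<open>
  At a low vertex the degree bounds of all its colours add up to its whole degree, so they are all tight.
\<close>

lemma low_tight:
  assumes vt: "(v, t) \<in> configs" and low: "v \<in> low_vertices P D X"
  shows "x \<in> X v \<Longrightarrow> card {u \<in> verts D - {v}. dir_arc H b x (t u)} = property_degree P b"
    and "dir_arc D b v w \<Longrightarrow> \<exists>x\<in>X v. dir_arc H b x (t w)"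
proof -
  have v: "v \<in> verts D" and tX: "\<And>u. u \<in> verts D - {v} \<Longrightarrow> t u \<in> X u" using vt unfolding configs_def by auto
  let ?N = "\<lambda>x. {u \<in> verts D - {v}. dir_arc H b x (t u)}"
  have finX: "finite (X v)" using finite_subset[OF list_verts[OF v] finH] .
  have ge: "property_degree P b \<le> card (?N x)" if x: "x \<in> X v" for x
  proof -
    have "property_degree P b \<le> card {u \<in> verts D - {v}. t u \<in> insert x (tokens v t) \<and> dir_arc H b x (t u)}"
      by (rule hole_degree[OF vt x filled_hole[OF vt x] subset_refl])
    also have "\<dots> \<le> card (?N x)" by (rule card_mono) (use finD in auto)
    finally show ?thesis .
  qed
  have liX: "y \<in> colours u" if "u \<in> verts D" "y \<in> X u" for u y using that unfolding colours_def by simp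
  have sub: "(\<Union>x\<in>X v. ?N x) \<subseteq> {u \<in> verts D. dir_arc D b v u}"
    using A_imp_R liX tX v by blast
  have sum: "(\<Sum>x\<in>X v. card (?N x)) = card (\<Union>x\<in>X v. ?N x)"
  proof (rule card_UN_disjoint[symmetric])
    show "\<forall>x\<in>X v. \<forall>y\<in>X v. x \<noteq> y \<longrightarrow> ?N x \<inter> ?N y = {}"
    proof (intro ballI impI equals0I)
      fix x y u assume xy: "x \<in> X v" "y \<in> X v" "x \<noteq> y" and u: "u \<in> ?N x \<inter> ?N y"
      show False
        using A_left_unique[OF liX[OF v xy(1)] liX[OF v xy(2)] liX[OF _ tX[of u]], of b] u xy(3) by simp
    qed
  qed (use finX finD in auto)
  have total: "card {u \<in> verts D. dir_arc D b v u} = property_degree P b * card (X v)"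
    using low dir_degree_simps[OF simpleD, of v] unfolding low_vertices_def dir_degree_def property_degree_def
    by (cases b) auto
  have fin: "finite {u \<in> verts D. dir_arc D b v u}" using finD by simp
  have le: "(\<Sum>x\<in>X v. card (?N x)) \<le> (\<Sum>x\<in>X v. property_degree P b)"
    using card_mono[OF fin sub] unfolding sum total by (simp add: mult.commute)
  have eq: "card (?N x) = property_degree P b" if x: "x \<in> X v" for x
  proof (rule ccontr)
    assume "card (?N x) \<noteq> property_degree P b"
    then have lt: "property_degree P b < card (?N x)" using ge[OF x] by simp
    have "(\<Sum>x\<in>X v. property_degree P b) < (\<Sum>x\<in>X v. card (?N x))"
    proof (rule sum_strict_mono_ex1[OF finX])
      show "\<forall>x\<in>X v. property_degree P b \<le> card (?N x)" using ge by blast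
      show "\<exists>x\<in>X v. property_degree P b < card (?N x)" using lt x by (rule bexI)
    qed
    then show False using le by simp
  qed
  then show "x \<in> X v \<Longrightarrow> card (?N x) = property_degree P b" .
  \<comment> \<open>Equal sizes turn the inclusion into an equality: every arc at \<open>v\<close>
    is covered.\<close>
  have "card (\<Union>x\<in>X v. ?N x) = card {u \<in> verts D. dir_arc D b v u}"
    unfolding sum[symmetric] total using eq by (simp add: mult.commute)
  then have "(\<Union>x\<in>X v. ?N x) = {u \<in> verts D. dir_arc D b v u}" using card_subset_eq[OF fin sub] by blast
  then show "dir_arc D b v w \<Longrightarrow> \<exists>x\<in>X v. dir_arc H b x (t w)"
    using dir_arc_verts[OF simpleD, of b v w] by blast
qed

text \<open>In direction \<open>b\<close> the colour \<open>x\<close> has exactly as many contacts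
  as a critical subdigraph requires. Dropping the contact \<open>t u\<close> leaves one too
  few.\<close>

lemma low_move:
  assumes vt: "(v, t) \<in> configs" and low: "v \<in> low_vertices P D X"
    and x: "x \<in> X v" and u: "u \<in> verts D" "u \<noteq> v" "dir_arc H b x (t u)"
  shows "(u, t(v := x)) \<in> configs"
proof -
  have v: "v \<in> verts D" and tX: "\<And>u. u \<in> verts D - {v} \<Longrightarrow> t u \<in> X u" using vt unfolding configs_def by auto
  let ?S = "tokens u (t(v := x))"
  have S: "?S = insert x (t ` (verts D - {v, u}))"
    unfolding tokens_def using v u by (auto simp: image_iff)
  \<comment> \<open>The dropped token is really gone: lists are disjoint, so no other vertex carries
    it.\<close>
  have notin: "t u \<notin> ?S"
  proof
    assume "t u \<in> ?S"
    then have "t u = x \<or> (\<exists>w\<in>verts D - {v, u}. t u = t w)" unfolding S by auto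
    then obtain w where w: "w \<in> verts D" "w \<noteq> u" "t u \<in> X w"
    proof (elim disjE bexE)
      assume "t u = x"
      then show thesis using that[of v] x v u by simp
    next
      fix w assume "w \<in> verts D - {v, u}" "t u = t w"
      then show thesis using that[of w] tX[of w] by simp
    qed
    then show False using list_disjoint[OF w(1) u(1) w(2)] tX[of u] u by blast
  qed
  have "H \<restriction> ?S \<in> P"
  proof (rule ccontr)
    assume bad: "H \<restriction> ?S \<notin> P"
    have sub: "?S \<subseteq> insert x (tokens v t)" unfolding S tokens_def by auto
    have "property_degree P b \<le> card {w \<in> verts D - {v}. t w \<in> ?S \<and> dir_arc H b x (t w)}"
      by (rule hole_degree[OF vt x bad sub])
    also have "\<dots> < card {w \<in> verts D - {v}. dir_arc H b x (t w)}"
      by (rule psubset_card_mono) (use finD u notin in auto)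
    also have "\<dots> = property_degree P b" using low_tight(1)[OF vt low x] .
    finally show False by simp
  qed
  then show ?thesis using u tX x unfolding configs_def by auto
qed

lemma low_sliding:
  assumes S: "S \<subseteq> low_vertices P D X"
  shows "sliding S {(v, t) \<in> configs. v \<in> S \<and> (\<forall>u\<in>verts D - S. t u = t0 u)}"
    (is "sliding S ?T")
proof -
  have SD: "S \<subseteq> verts D" using S unfolding low_vertices_def by auto
  have liX: "colours u = X u" if "u \<in> S" for u using that SD unfolding colours_def by auto
  have split: "card {u \<in> verts D - {v}. dir_arc H b x (t u)} =
      card {u \<in> S - {v}. dir_arc H b x (t u)} + card {u \<in> verts D - S. dir_arc H b x (t0 u)}"
    if "(v, t) \<in> ?T" for v t x b
  proof -
    have "{u \<in> verts D - {v}. dir_arc H b x (t u)} =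
        {u \<in> S - {v}. dir_arc H b x (t u)} \<union> {u \<in> verts D - S. dir_arc H b x (t0 u)}"
      using that SD by auto
    moreover have "finite {u \<in> S - {v}. dir_arc H b x (t u)}" "finite {u \<in> verts D - S. dir_arc H b x (t0 u)}"
      using finD finite_subset[OF SD finD] by simp_all
    moreover have "{u \<in> S - {v}. dir_arc H b x (t u)} \<inter> {u \<in> verts D - S. dir_arc H b x (t0 u)} = {}"
      by blast
    ultimately show ?thesis by (simp only: card_Un_disjoint)
  qed
  show ?thesis
    unfolding sliding_def
  proof (intro conjI allI impI)
    show "finite S" using finite_subset[OF SD finD] .
  next
    fix v t assume vt: "(v, t) \<in> ?T"
    then have c: "(v, t) \<in> configs" and vS: "v \<in> S" and t0: "\<forall>u\<in>verts D - S. t u = t0 u" by auto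
    show "v \<in> S" by (rule vS)
    show "\<forall>u\<in>S - {v}. t u \<in> colours u" using c SD liX unfolding configs_def by auto
    have low: "v \<in> low_vertices P D X" using vS S by blast
    fix u b x assume u: "u \<in> S - {v}"
    { assume "dir_arc D b v u"
      then show "\<exists>x\<in>colours v. dir_arc H b x (t u)" using low_tight(2)[OF c low] liX[OF vS] by simp }
    { assume "x \<in> colours v" "dir_arc H b x (t u)"
      then have "(u, t(v := x)) \<in> configs" using low_move[OF c low, of x u b] u SD liX[OF vS] by auto
      then show "(u, t(v := x)) \<in> ?T" using u vS t0 by auto }
  next
    fix v t t' x b
    assume *: "(v, t) \<in> ?T" "(v, t') \<in> ?T" "x \<in> colours v"
    then have "card {u \<in> verts D - {v}. dir_arc H b x (t u)} = card {u \<in> verts D - {v}. dir_arc H b x (t' u)}"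
      using low_tight(1)[of v t x b] low_tight(1)[of v t' x b] liX[of v] S by auto
    then show "card {u \<in> S - {v}. dir_arc H b x (t u)} = card {u \<in> S - {v}. dir_arc H b x (t' u)}"
      using split[OF *(1), of b x] split[OF *(2), of b x] by simp
  qed
qed

end

section \<open>Recognising complete digraphs, cycles and dibricks\<close>

lemma complete_digraphI:
  assumes G: "simple_digraph G"
    and adj: "\<And>u v. u \<in> verts G \<Longrightarrow> v \<in> verts G \<Longrightarrow> u \<noteq> v \<Longrightarrow> (u, v) \<in> arcs G"
  shows "complete_digraph (card (verts G)) G"
proof -
  interpret digraph G using G unfolding simple_digraph_def by simp
  have ends: "arcs_ends G = {(u, v). (u, v) \<in> verts G \<times> verts G \<and> u \<noteq> v}"
    using G adj unfolding arcs_ends_def arc_to_ends_def simple_digraph_iff by force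
  have "graph G"
    by unfold_locales (auto simp: symmetric_def ends sym_def)
  then show ?thesis unfolding complete_digraph_def using ends by simp
qed

lemma cycle_graph_iso:
  fixes G :: "'a dgraph"
  assumes "wf_digraph G" "tail G = fst" "head G = snd" and c: "cycle_enum E n c (verts G)"
    and adj: "\<And>u v. u \<in> verts G \<Longrightarrow> v \<in> verts G \<Longrightarrow> (u, v) \<in> arcs G \<longleftrightarrow> E u v"
  shows "digraph_iso G (with_proj (cycle_graph n))"
proof (rule digraph_isoI)
  let ?C = "with_proj (cycle_graph n)" and ?f = "the_inv_into {..<n} c"
  have C: "verts ?C = {..<n}"
    "arcs ?C = {(i, j). i < n \<and> j < n \<and> (j = (i + 1) mod n \<or> i = (j + 1) mod n)}"
    "tail ?C = fst" "head ?C = snd"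
    unfolding cycle_graph_def with_proj_def by simp_all
  then show "tail ?C = fst" "head ?C = snd" by simp_all
  show "wf_digraph ?C" unfolding wf_digraph_def C by auto
  have bij: "bij_betw c {..<n} (verts G)" using c unfolding cycle_enum_def by simp
  then have img: "c ` {..<n} = verts G" and inj: "inj_on c {..<n}" unfolding bij_betw_def by auto
  show "bij_betw ?f (verts G) (verts ?C)" unfolding C by (rule bij_betw_the_inv_into[OF bij])
  show "(u, v) \<in> arcs G \<longleftrightarrow> (?f u, ?f v) \<in> arcs ?C" if uv: "u \<in> verts G" "v \<in> verts G" for u v
  proof -
    have "u \<in> c ` {..<n}" "v \<in> c ` {..<n}" using uv img by simp_all
    then obtain i j where ij: "i < n" "j < n" "u = c i" "v = c j" by auto
    have "?f u = i" "?f v = j" using ij by (simp_all add: the_inv_into_f_f[OF inj])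
    moreover have "E u v \<longleftrightarrow> j = (i + 1) mod n \<or> i = (j + 1) mod n"
      using c ij unfolding cycle_enum_def by blast
    ultimately show ?thesis using adj[OF uv] ij C(2) by simp
  qed
qed (use assms in auto)

text \<open>Both sides count the arcs. This is the source of \<open>d_plus P = d_minus P\<close> for
  critical blocks.\<close>

lemma sum_dir_degree:
  assumes "finite (verts G)"
  shows "(\<Sum>v\<in>verts G. dir_degree G True v) = (\<Sum>v\<in>verts G. dir_degree G False v)"
proof -
  have card: "dir_degree G b v = (\<Sum>u\<in>verts G. if dir_arc G b v u then 1 else 0)" for b v
    unfolding dir_degree_def using assms by (simp add: sum.If_cases Int_def)
  have flip: "dir_arc G False v u \<longleftrightarrow> dir_arc G True u v" for u v unfolding dir_arc_def by simp
  show ?thesis unfolding card flip by (rule sum.swap)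
qed

context critical_cover_system
begin

text \<open>If \<open>B\<close> is not in \<open>P\<close>, it is critical; then criticality bounds
  its degrees from below and \<open>deg\<close> from above by the same constants, and counting arcs
  at both ends equates the two constants.\<close>

lemma monochromatic_block:
  assumes B: "simple_digraph B" "connected_digraph B"
    and iso: "\<And>S. S \<subseteq> verts B \<Longrightarrow> digraph_iso (H \<restriction> (x ` S)) (B \<restriction> S)"
    and del: "\<And>v. v \<in> verts B \<Longrightarrow> H \<restriction> (x ` (verts B - {v})) \<in> P"
    and deg: "\<And>v b. v \<in> verts B \<Longrightarrow> dir_degree B b v \<le> property_degree P b"
  shows "dibrick P B"
proof -
  have closed: "\<And>G G'. G \<in> P \<Longrightarrow> simple_digraph G' \<Longrightarrow> digraph_iso G G' \<Longrightarrow> G' \<in> P"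
    using reliable unfolding reliable_def digraph_property_def by blast
  have out: "out_degree B v = dir_degree B True v" and inn: "in_degree B v = dir_degree B False v" for v
    using dir_degree_simps[OF B(1)] by simp_all
  have finB: "finite (verts B)" and ne: "verts B \<noteq> {}"
    using B connected_iff_conn[OF B(1)] unfolding simple_digraph_iff by auto
  have le: "out_degree B v \<le> d_plus P" "in_degree B v \<le> d_minus P" if "v \<in> verts B" for v
    using deg[OF that, of True] deg[OF that, of False] unfolding out inn property_degree_def by simp_all
  show ?thesis
  proof (cases "B \<in> P")
    case True
    have "max_out_degree B \<le> d_plus P" "max_in_degree B \<le> d_minus P"
      unfolding max_out_degree_def max_in_degree_def using finB ne le by simp_all
    then show ?thesis unfolding dibrick_def using B True by blast
  next
    case False
    have "delete_vertex B v \<in> P" if v: "v \<in> verts B" for v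
    proof -
      have "delete_vertex B v = B \<restriction> (verts B - {v})"
        using del_vert_induce[of B "verts B" v] induce_verts[OF B(1)] by simp
      then show ?thesis
        using closed[OF del[OF v] _ iso] induce_simple[OF B(1), of "verts B - {v}"] by simp
    qed
    then have CR: "B \<in> CR P" unfolding CR_def using B False by simp
    have eq: "dir_degree B b v = property_degree P b" if "v \<in> verts B" for b v
      using property_degree_le[OF CR that, of b] deg[OF that, of b] by simp
    have "card (verts B) * d_plus P = card (verts B) * d_minus P"
      using sum_dir_degree[OF finB] by (simp add: eq property_degree_def)
    then have "d_plus P = d_minus P" using finB ne by simp
    then show ?thesis
      unfolding dibrick_def eulerian_def out inn using B CR eq by (simp add: property_degree_def)
  qed
qed

theorem low_block:
  assumes block: "block (D \<restriction> low_vertices P D X) B"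
  shows "dibrick P B \<or> (\<exists>n. even n \<and> bidirected_cycle n B) \<or> antidirected_cycle B"
proof -
  let ?L = "low_vertices P D X"
  let ?S = "verts B"
  have LD: "?L \<subseteq> verts D" unfolding low_vertices_def by blast
  have simpleL: "simple_digraph (D \<restriction> ?L)" using induce_simple[OF simpleD LD] .
  have SL: "?S \<subseteq> ?L" and ne: "?S \<noteq> {}" and bicL: "biconn (adj (D \<restriction> ?L)) ?S"
    and BL: "B = (D \<restriction> ?L) \<restriction> ?S"
    using block_biconn[OF simpleL block] by auto
  have SD: "?S \<subseteq> verts D" using SL LD by blast
  have bic: "biconn E ?S" unfolding E_eq_adj
    by (rule biconn_mono[OF bicL]) (auto simp: adj_def induce_subgraph_def)
  have "(D \<restriction> ?L) \<restriction> ?S = D \<restriction> ?S" using SL by (intro dgraph_eqI) (auto simp: induce_subgraph_def)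
  with BL have BD: "B = D \<restriction> ?S" by simp
  have simpleB: "simple_digraph B" using induce_simple[OF simpleD SD] BD by simp
  have arcB: "dir_arc B b u v \<longleftrightarrow> dir_arc D b u v" if "u \<in> ?S" "v \<in> ?S" for b u v
    using dir_arc_induce[OF simpleD, of ?S b u v] that BD by simp
  have finS: "finite ?S" using finite_subset[OF SD finD] .
  have conn: "conn E ?S" using bic unfolding biconn_def by blast
  have adjB: "adj B u v \<longleftrightarrow> E u v" if "u \<in> ?S" "v \<in> ?S" for u v
    using arcB[OF that, of True] arcB[OF that, of False] unfolding E_eq_adj dir_arc_def adj_def by simp
  have "conn (adj B) ?S" by (rule conn_mono[OF conn]) (simp add: adjB)
  then have connB: "connected_digraph B" using connected_iff_conn[OF simpleB] ne by simp
  obtain v0 where v0: "v0 \<in> ?S" using ne by blast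
  obtain t0 where t0: "(v0, t0) \<in> configs" using configs_nonempty v0 SD by blast
  \<comment> \<open>Everything outside the block is frozen as in \<open>t0\<close>, tokens on other
    low vertices included.\<close>
  define T where "T = {(v, t) \<in> configs. v \<in> ?S \<and> (\<forall>u\<in>verts D - ?S. t u = t0 u)}"
  have sl: "sliding ?S T" unfolding T_def by (rule low_sliding[OF SL])
  have v0T: "(v0, t0) \<in> T" unfolding T_def using v0 t0 by blast
  then have Tne: "T \<noteq> {}" by blast
  consider "card ?S = 1" | "2 \<le> card ?S" "card (col ?S T v0) \<le> 1" | "2 \<le> card ?S" "2 \<le> card (col ?S T v0)"
    using card_gt_0_iff[of ?S] finS ne by linarith
  then show ?thesis
  proof cases
    \<comment> \<open>A single vertex is the complete digraph on one vertex.\<close>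
    case 1
    then obtain v where "?S = {v}" by (rule card_1_singletonE)
    then have "complete_digraph (card ?S) B" by (intro complete_digraphI[OF simpleB]) auto
    then show ?thesis unfolding dibrick_def using simpleB connB 1 by auto
  next
    case 2
    obtain x where x: "\<And>u. u \<in> ?S \<Longrightarrow> x u \<in> colours u"
      and token: "\<And>v t u. (v, t) \<in> T \<Longrightarrow> u \<in> ?S - {v} \<Longrightarrow> t u = x u"
      and arc: "\<And>u w b. u \<in> ?S \<Longrightarrow> w \<in> ?S \<Longrightarrow> dir_arc D b u w \<longleftrightarrow> dir_arc H b (x u) (x w)"
      using monochromatic[OF sl bic 2(1) v0T 2(2)] by blast
    have xX: "x u \<in> X u" if "u \<in> ?S" for u using x[OF that] that SD unfolding colours_def by auto
    have xH: "x ` ?S \<subseteq> verts H" using xX list_verts SD by blast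
    have inj: "inj_on x ?S"
    proof (intro inj_onI, rule ccontr)
      fix u w assume uw: "u \<in> ?S" "w \<in> ?S" "x u = x w" "u \<noteq> w"
      then have "X u \<inter> X w = {}" using list_disjoint[of u w] SD by blast
      then show False using xX[OF uw(1)] xX[OF uw(2)] uw(3) by auto
    qed
    have "dibrick P B"
    proof (rule monochromatic_block[OF simpleB connB, of x])
      show "digraph_iso (H \<restriction> (x ` S)) (B \<restriction> S)" if S: "S \<subseteq> ?S" for S
      proof (rule digraph_isoI)
        let ?f = "the_inv_into S x"
        have injS: "inj_on x S" using inj S inj_on_subset by blast
        have simples: "simple_digraph (H \<restriction> (x ` S))" "simple_digraph (B \<restriction> S)"
          using induce_simple[OF simpleH, of "x ` S"] induce_simple[OF simpleB S] xH S by auto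
        then show "tail (H \<restriction> (x ` S)) = fst" "head (H \<restriction> (x ` S)) = snd" "tail (B \<restriction> S) = fst" "head (B \<restriction> S) = snd"
          unfolding simple_digraph_iff by auto
        show "wf_digraph (H \<restriction> (x ` S))" "wf_digraph (B \<restriction> S)"
          using simples by (simp_all add: simple_digraph_wf)
        show "bij_betw ?f (verts (H \<restriction> (x ` S))) (verts (B \<restriction> S))"
          using bij_betw_the_inv_into[of x S "x ` S"] injS unfolding bij_betw_def by simp
        fix p q assume "p \<in> verts (H \<restriction> (x ` S))" "q \<in> verts (H \<restriction> (x ` S))"
        then obtain u w where uw: "u \<in> S" "w \<in> S" "p = x u" "q = x w" by auto
        then have "?f p = u" "?f q = w" by (simp_all add: the_inv_into_f_f[OF injS])
        moreover have "(p, q) \<in> arcs (H \<restriction> (x ` S)) \<longleftrightarrow> (u, w) \<in> arcs (B \<restriction> S)"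
          using dir_arc_induce[OF simpleH, of "x ` S" True p q] dir_arc_induce[OF simpleB, of S True u w]
            arc[of u w True] arcB[of u w True] uw S unfolding dir_arc_def by auto
        ultimately show "(p, q) \<in> arcs (H \<restriction> (x ` S)) \<longleftrightarrow> (?f p, ?f q) \<in> arcs (B \<restriction> S)" by simp
      qed
      fix v assume v: "v \<in> ?S"
      obtain t where t: "(v, t) \<in> T" using exists_hole[OF sl conn Tne v] by blast
      then have tc: "(v, t) \<in> configs" unfolding T_def by blast
      have tt: "t u = x u" if "u \<in> ?S - {v}" for u using token[OF t that] .
      show "H \<restriction> (x ` (?S - {v})) \<in> P"
      proof (rule hereditary_induce[of "tokens v t"])
        show "H \<restriction> tokens v t \<in> P" using tc unfolding configs_def by blast
        have "x ` (?S - {v}) = t ` (?S - {v})" using tt by (intro image_cong) auto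
        then show "x ` (?S - {v}) \<subseteq> tokens v t" unfolding tokens_def using SD by blast
        show "tokens v t \<subseteq> verts H" using tc list_verts unfolding tokens_def configs_def by blast
      qed
      fix b
      \<comment> \<open>Each neighbour of \<open>v\<close> in \<open>B\<close> carries a contact of
        \<open>x v\<close>, and the low vertex \<open>v\<close> allows no more contacts than
        \<open>property_degree P b\<close>.\<close>
      have "dir_degree B b v \<le> card {u \<in> verts D - {v}. dir_arc H b (x v) (t u)}"
        unfolding dir_degree_def
      proof (rule card_mono)
        show "{u \<in> ?S. dir_arc B b v u} \<subseteq> {u \<in> verts D - {v}. dir_arc H b (x v) (t u)}"
        proof
          fix u assume "u \<in> {u \<in> ?S. dir_arc B b v u}"
          then have u: "u \<in> ?S" "dir_arc B b v u" by auto
          then have "u \<noteq> v" using dir_arc_verts[OF simpleB] by blast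
          then show "u \<in> {u \<in> verts D - {v}. dir_arc H b (x v) (t u)}"
            using u arcB[OF v u(1), of b] arc[OF v u(1), of b] tt[of u] SD by auto
        qed
      qed (use finD in simp)
      also have "\<dots> = property_degree P b"
        by (rule low_tight(1)[OF tc _ xX[OF v]]) (use v SL in blast)
      finally show "dir_degree B b v \<le> property_degree P b" .
    qed
    then show ?thesis by simp
  next
    case 3
    \<comment> \<open>On two vertices each direction has at most one arc at \<open>v0\<close>, too
      few for two active colours.\<close>
    have "card ?S \<noteq> 2"
    proof
      assume "card ?S = 2"
      then obtain w where w: "?S = {v0, w}" "v0 \<noteq> w"
        using v0 unfolding card_2_iff by (metis insert_commute insertE singletonD)
      have "?S \<noteq> {v0}" using w by auto
      then obtain a where "a \<in> ?S" "E v0 a" using conn_crossing[OF conn, of "{v0}"] v0 by auto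
      then obtain b where b: "dir_arc D b v0 a" "a \<in> ?S" unfolding E_def by blast
      have "card (col ?S T v0) \<le> card {u \<in> ?S. dir_arc D b v0 u}"
        by (rule card_col_le_degree[OF sl bic Tne b(1) v0 b(2)])
      also have "\<dots> \<le> card {w}" by (rule card_mono) (use w R_irrefl in auto)
      finally show False using 3(2) by simp
    qed
    then have three: "3 \<le> card ?S" using 3(1) by simp
    from polychromatic[OF sl bic three v0T 3(2)] show ?thesis
    proof (elim disjE exE conjE)
      assume all: "\<forall>u\<in>?S. \<forall>w\<in>?S. u \<noteq> w \<longrightarrow> (\<forall>d. dir_arc D d u w)"
      have "complete_digraph (card ?S) B"
      proof (rule complete_digraphI[OF simpleB])
        show "(u, v) \<in> arcs B" if "u \<in> ?S" "v \<in> ?S" "u \<noteq> v" for u v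
          using all[rule_format, OF that, of True] arcB[OF that(1,2), of True] unfolding dir_arc_def by simp
      qed
      moreover have "1 \<le> card ?S" using three by simp
      ultimately show ?thesis unfolding dibrick_def using simpleB connB by blast
    next
      fix n c assume c: "cycle_enum E n c ?S"
        and same: "\<forall>u\<in>?S. \<forall>a\<in>?S. \<forall>b\<in>?S. E u a \<longrightarrow> E u b \<longrightarrow> (\<forall>d. dir_arc D d u a \<longleftrightarrow> dir_arc D d u b)"
      have n: "3 \<le> n" using c unfolding cycle_enum_def by simp
      have th: "tail B = fst" "head B = snd" using simpleB unfolding simple_digraph_iff by auto
      have arcsB: "(u, v) \<in> arcs B \<longleftrightarrow> dir_arc D True u v" if "u \<in> ?S" "v \<in> ?S" for u v
        using arcB[OF that, of True] unfolding dir_arc_def by simp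
      show ?thesis
      \<comment> \<open>One digon spreads: a vertex treats its neighbours alike, so all edges at it
        are digons, and the property passes on along edges. Without a digon every vertex has arcs in
        one direction only.\<close>
      proof (cases "\<exists>u\<in>?S. \<exists>a\<in>?S. \<forall>d. dir_arc D d u a")
        case True
        then obtain u0 a0 where u0: "u0 \<in> ?S" "a0 \<in> ?S" "\<And>d. dir_arc D d u0 a0" by blast
        have bi: "\<forall>a\<in>?S. E u a \<longrightarrow> (\<forall>d. dir_arc D d u a)" if u: "u \<in> ?S" for u
        proof (rule conn_induct[OF conn u0(1) u])
          show "\<forall>a\<in>?S. E u0 a \<longrightarrow> (\<forall>d. dir_arc D d u0 a)"
            using same u0 R_imp_E by blast
        next
          fix p q assume pq: "p \<in> ?S" "q \<in> ?S" "\<forall>a\<in>?S. E p a \<longrightarrow> (\<forall>d. dir_arc D d p a)" "E p q"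
          then have "dir_arc D d q p" for d using R_not[of d p q] by blast
          then show "\<forall>a\<in>?S. E q a \<longrightarrow> (\<forall>d. dir_arc D d q a)"
            using same pq(1,2) R_imp_E by blast
        qed
        have "digraph_iso B (with_proj (cycle_graph n))"
        proof (rule cycle_graph_iso[OF simple_digraph_wf[OF simpleB] th c])
          show "(u, v) \<in> arcs B \<longleftrightarrow> E u v" if "u \<in> ?S" "v \<in> ?S" for u v
            unfolding arcsB[OF that] using bi[OF that(1)] that(2) R_imp_E by blast
        qed
        then have "bidirected_cycle n B" unfolding bidirected_cycle_def using n by simp
        \<comment> \<open>Odd bidirected cycles are dibricks; even ones are the separate
          outcome.\<close>
        then show ?thesis unfolding dibrick_def using simpleB connB by (cases "even n") auto
      next
        case False
        have "digraph_iso (with_proj (mk_symmetric B)) (with_proj (cycle_graph n))"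
        proof (rule cycle_graph_iso)
          show "cycle_enum E n c (verts (with_proj (mk_symmetric B)))"
            using c mk_symmetric_simps(1)[OF simpleB] by simp
          show "(u, v) \<in> arcs (with_proj (mk_symmetric B)) \<longleftrightarrow> E u v"
            if "u \<in> verts (with_proj (mk_symmetric B))" "v \<in> verts (with_proj (mk_symmetric B))" for u v
          proof -
            have uv: "u \<in> ?S" "v \<in> ?S" using that mk_symmetric_simps(1)[OF simpleB] by auto
            then show ?thesis using adjB[OF uv] mk_symmetric_simps(2)[OF simpleB] by simp
          qed
        qed (use mk_symmetric_simps[OF simpleB] in auto)
        moreover have "in_degree B v = 0 \<or> out_degree B v = 0" if v: "v \<in> ?S" for v
        proof (rule ccontr)
          assume "\<not> ?thesis"
          then have "dir_degree B True v \<noteq> 0" "dir_degree B False v \<noteq> 0"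
            using dir_degree_simps[OF simpleB] by auto
          then have "{u \<in> ?S. dir_arc B True v u} \<noteq> {}" "{u \<in> ?S. dir_arc B False v u} \<noteq> {}"
            unfolding dir_degree_def by (metis card.empty)+
          then obtain a b where ab: "a \<in> ?S" "b \<in> ?S" "dir_arc D True v a" "dir_arc D False v b"
            using arcB v by blast
          then have "dir_arc D False v a" using same v R_imp_E by blast
          then have "dir_arc D d v a" for d using ab(3) by (cases d) auto
          then show False using False v ab(1) by blast
        qed
        ultimately have "antidirected_cycle B" unfolding antidirected_cycle_def using n
          by (intro conjI exI[of _ n] ballI) simp_all
        then show ?thesis by simp
      qed
    qed
  qed
qed

end

theorem theorem8:
  fixes P :: "'a::infinite dgraph set"
    and D H B :: "'a dgraph"
    and X :: "'a \<Rightarrow> 'a set"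
  assumes "reliable P"
    and "simple_digraph D"
    and "critical_cover P D X H"
    and "block (D \<restriction> low_vertices P D X) B"
  shows "dibrick P B \<or> (\<exists>n. even n \<and> bidirected_cycle n B) \<or> antidirected_cycle B"
proof -
  interpret critical_cover_system P D H X
    using assms(1-3) by unfold_locales
  show ?thesis by (rule low_block[OF assms(4)])
qed

end
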